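(* Let $Y_1,\dots,Y_q$ be locally Lipschitz vector fields on $\mathbb{R}^n$ satisfying condition (H), and let $\Omega\subset\mathbb{R}^n$ be bounded. Then there is $C>0$ such that for every $x\in\Omega$, every subunit path $\gamma:[0,T]\to\mathbb{R}^n$ with $\gamma(0)=x$, and every $p\in\{1,\dots,\min\{q,n\}\}$, $$|\Lambda_p(\gamma(t))-\Lambda_p(x)|\le|\Lambda_p(x)|(e^{Ct}-1)\quad\text{for all }t\in[0,\min\{T,C^{-1}\}].$$ In particular, for every $I\in\mathcal{I}(p,q)$, $$|Y_I(\gamma(t))-Y_I(x)|\le C|\Lambda_p(x)|(e^{Ct}-1)\quad\text{for all }t\in[0,\min\{T,C^{-1}\}].$$
   Context: $Y_j=\sum_\alpha g_j^\alpha\partial_\alpha$ with $g_j$ locally Lipschitz. Condition (H): for every bounded open $\Omega'$ there is $C_{\Omega'}$ with $(Y_jg_k(x)-Y_kg_j(x))\cdot\nabla\in\{\sum_i c_iY_i(x):|c|\le C_{\Omega'}\}$ for a.e. $x\in\Omega'$, all $j,k$ (with $Y_jg_k=Dg_k\,g_j$, a.e.). Subunit path: Lipschitz $\gamma$ with $\dot\gamma=\sum_ju_j(t)Y_j(\gamma)$ a.e., $|u(t)|\le1$ a.e. For $1\le p\le\mu$, $\mathcal{I}(p,\mu):=\{(i_1,\dots,i_p):1\le i_1<\dots<i_p\le\mu\}$. For $I\in\mathcal{I}(p,q)$, $Y_I(x):=Y_{i_1}(x)\wedge\cdots\wedge Y_{i_p}(x)\in\bigwedge_p\mathbb{R}^n$,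 and for $K\in\mathcal{I}(p,n)$, $Y_I^K(x):=\det\big(g_{i_b}^{k_a}(x)\big)_{a,b=1}^p$, so that $Y_I=\sum_K Y_I^Ke_K$ with $\{e_K=e_{k_1}\wedge\dots\wedge e_{k_p}\}$ orthonormal and $|Y_I|^2=\sum_K(Y_I^K)^2$. $\Lambda_p(x):=(Y_J^K(x))_{J\in\mathcal{I}(p,q),K\in\mathcal{I}(p,n)}$ with Euclidean norm $|\Lambda_p(x)|^2=\sum_{J,K}Y_J^K(x)^2$. *)

theory Defs
  imports "HOL-Analysis.Analysis"
begin

text \<open>R^n is modelled as real^'n with 'n a finite linearly ordered index type
(the order fixes the coordinate order e_1,...,e_n). Vector fields Y_1..Y_q are
given by their coefficient maps g j :: real^'n => real^'n, j < q (0-based).\<close>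

definition locally_lipschitz :: "('a::metric_space \<Rightarrow> 'b::metric_space) \<Rightarrow> bool" where
  "locally_lipschitz f \<longleftrightarrow> (\<forall>x. \<exists>e>0. \<exists>L. L-lipschitz_on (ball x e) f)"

definition coef_norm :: "nat \<Rightarrow> (nat \<Rightarrow> real) \<Rightarrow> real" where
  "coef_norm q c = sqrt (\<Sum>i<q. (c i)\<^sup>2)"

text \<open>Condition (H). Y_j g_k(x) = Dg_k(x) g_j(x), where Dg_k is the (a.e. existing)
derivative of the Lipschitz map g_k.\<close>
definition condH :: "nat \<Rightarrow> (nat \<Rightarrow> real^'n \<Rightarrow> real^'n) \<Rightarrow> bool" where
  "condH q g \<longleftrightarrow>
    (\<forall>\<Omega>'. bounded \<Omega>' \<and> open \<Omega>' \<longrightarrow>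
      (\<exists>C. AE x in lebesgue. x \<in> \<Omega>' \<longrightarrow>
          (\<forall>k<q. g k differentiable (at x)) \<and>
          (\<forall>j<q. \<forall>k<q. \<exists>c. coef_norm q c \<le> C \<and>
              frechet_derivative (g k) (at x) (g j x) - frechet_derivative (g j) (at x) (g k x)
                = (\<Sum>i<q. c i *\<^sub>R g i x))))"

definition subunit_path ::
    "nat \<Rightarrow> (nat \<Rightarrow> real^'n \<Rightarrow> real^'n) \<Rightarrow> real \<Rightarrow> (real \<Rightarrow> real^'n) \<Rightarrow> bool" where
  "subunit_path q g T \<gamma> \<longleftrightarrow> 0 \<le> T \<and> (\<exists>L. L-lipschitz_on {0..T} \<gamma>) \<and>
     (\<exists>u :: real \<Rightarrow> nat \<Rightarrow> real. AE t in lborel. t \<in> {0..T} \<longrightarrow>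
        (\<gamma> has_vector_derivative (\<Sum>j<q. u t j *\<^sub>R g j (\<gamma> t))) (at t within {0..T}) \<and>
        coef_norm q (u t) \<le> 1)"

definition det_nat :: "nat \<Rightarrow> (nat \<Rightarrow> nat \<Rightarrow> real) \<Rightarrow> real" where
  "det_nat p M = (\<Sum>\<sigma>\<in>{\<sigma>. \<sigma> permutes {..<p}}. of_int (sign \<sigma>) * (\<Prod>a<p. M a (\<sigma> a)))"

text \<open>Multi-indices: I(p,q) is represented by p-element subsets J of {0..<q}
(listed increasingly), I(p,n) by p-element subsets K of the coordinate type.\<close>
definition multi_idx :: "nat \<Rightarrow> nat \<Rightarrow> nat set set" where
  "multi_idx p q = {J. J \<subseteq> {..<q} \<and> card J = p}"

definition coord_idx :: "nat \<Rightarrow> ('n::{finite,linorder}) set set" where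
  "coord_idx p = {K. card K = p}"

definition YIK :: "(nat \<Rightarrow> real^('n::{finite,linorder}) \<Rightarrow> real^('n::{finite,linorder})) \<Rightarrow> nat set \<Rightarrow> ('n::{finite,linorder}) set \<Rightarrow> real^('n::{finite,linorder}) \<Rightarrow> real" where
  "YIK g J K x = (let js = sorted_list_of_set J; ks = sorted_list_of_set K in
      det_nat (card J) (\<lambda>a b. g (js ! b) x $ (ks ! a)))"

text \<open>|Y_I(y) - Y_I(x)| in the exterior power, via orthonormal basis e_K.\<close>
definition YI_dist :: "(nat \<Rightarrow> real^('n::{finite,linorder}) \<Rightarrow> real^('n::{finite,linorder})) \<Rightarrow> nat \<Rightarrow> nat set \<Rightarrow> real^('n::{finite,linorder}) \<Rightarrow> real^('n::{finite,linorder}) \<Rightarrow> real" where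
  "YI_dist g p I y x = sqrt (\<Sum>K\<in>coord_idx p. (YIK g I K y - YIK g I K x)\<^sup>2)"

definition Lambda_norm :: "nat \<Rightarrow> (nat \<Rightarrow> real^('n::{finite,linorder}) \<Rightarrow> real^('n::{finite,linorder})) \<Rightarrow> nat \<Rightarrow> real^('n::{finite,linorder}) \<Rightarrow> real" where
  "Lambda_norm q g p x = sqrt (\<Sum>J\<in>multi_idx p q. \<Sum>K\<in>coord_idx p. (YIK g J K x)\<^sup>2)"

definition Lambda_dist :: "nat \<Rightarrow> (nat \<Rightarrow> real^('n::{finite,linorder}) \<Rightarrow> real^('n::{finite,linorder})) \<Rightarrow> nat \<Rightarrow> real^('n::{finite,linorder}) \<Rightarrow> real^('n::{finite,linorder}) \<Rightarrow> real" where
  "Lambda_dist q g p y x = sqrt (\<Sum>J\<in>multi_idx p q. \<Sum>K\<in>coord_idx p. (YIK g J K y - YIK g J K x)\<^sup>2)"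

end

theory Submission
  imports Defs
begin

text \<open>Differentiating a minor \<open>Y\<^sub>J\<^sup>K\<close> along \<open>Y\<^sub>k\<close> and using the bracket condition to exchange
  \<open>Dg\<^sub>j g\<^sub>k\<close> for \<open>Dg\<^sub>k g\<^sub>j\<close> gives \<open>|Y\<^sub>k \<Lambda>\<^sub>p| \<le> A |\<Lambda>\<^sub>p|\<close> almost everywhere. A path may be a null set, so this
  cannot be integrated along \<open>\<gamma>\<close> itself. By Fubini, however, for almost every \<open>h\<close> the inequality holds
  at \<open>\<gamma>(t) + h\<close> for almost every \<open>t\<close>; since \<open>\<gamma>'(t)\<close> differs from a subunit combination of the fields at
  \<open>\<gamma>(t) + h\<close> by \<open>O(|h|)\<close>, Gronwall's inequality applies to \<open>t \<mapsto> \<Lambda>\<^sub>p(\<gamma>(t) + h)\<close> with an error \<open>O(|h|)\<close>,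
  and \<open>h \<rightarrow> 0\<close> gives the claim.\<close>

subsection \<open>Determinants and minors\<close>

text \<open>The exchange is what makes the estimate linear in \<Lambda>_p. Before it, each column of
  a minor is multiplied by the Jacobian of its own field, and the bound then available is a power of
  the size of the fields, not |\<Lambda>_p|. After it, only determinants of entries of the fields
  remain, with changed index sets. Both J and K may change, so a single minor, or a single Y_I, need
  not satisfy a closed inequality. The full array does, and this is why |\<Lambda>_p(x)| stands on
  the right even in the estimate for Y_I. The crude bound by field sizes is still used for the
  mismatch between the fields at \<gamma>(t) and at \<gamma>(t) + h, where the factor |h| makes it
  harmless. The limiting inequality is homogeneous in \<Lambda>_p, which leaves the factor
  |\<Lambda>_p(x)| in front of the exponential term. The restriction t \<le> 1/C serves to confine
  the path to a fixed ball, on which the Lipschitz, sup and bracket constants are uniform.\<close>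

lemma det_nat_cong:
  assumes "\<And>a b. a < p \<Longrightarrow> b < p \<Longrightarrow> M a b = N a b"
  shows "det_nat p M = det_nat p N"
  unfolding det_nat_def
proof (intro sum.cong refl arg_cong2[where f="(*)"] prod.cong)
  fix \<sigma> :: "nat \<Rightarrow> nat" and a assume "\<sigma> \<in> {\<sigma>. \<sigma> permutes {..<p}}" "a \<in> {..<p}"
  then show "M a (\<sigma> a) = N a (\<sigma> a)"
    using permutes_in_image[of \<sigma> "{..<p}" a] assms by simp
qed

lemma det_nat_transpose: "det_nat p (\<lambda>a b. M b a) = det_nat p M"
proof -
  have "det_nat p (\<lambda>a b. M b a) =
      (\<Sum>\<sigma> | \<sigma> permutes {..<p}. of_int (sign (inv \<sigma>)) * (\<Prod>a<p. M (inv \<sigma> a) a))"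
    unfolding det_nat_def by (rule sum_permutations_inverse)
  also have "\<dots> = det_nat p M"
    unfolding det_nat_def
  proof (intro sum.cong refl arg_cong2[where f="(*)"])
    fix \<sigma> :: "nat \<Rightarrow> nat" assume "\<sigma> \<in> {\<sigma>. \<sigma> permutes {..<p}}"
    then have s: "\<sigma> permutes {..<p}" by simp
    show "of_int (sign (inv \<sigma>)) = (of_int (sign \<sigma>) :: real)"
      using s by (simp add: sign_inverse permutes_imp_permutation[OF finite_lessThan])
    have "(\<Prod>a<p. M (inv \<sigma> a) a) = (\<Prod>a<p. M (inv \<sigma> (\<sigma> a)) (\<sigma> a))"
      using s by (intro prod.reindex_bij_betw[symmetric] permutes_imp_bij)
    then show "(\<Prod>a<p. M (inv \<sigma> a) a) = (\<Prod>a<p. M a (\<sigma> a))"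
      using s by (simp add: permutes_inverses)
  qed
  finally show ?thesis .
qed

lemma det_nat_permute_columns:
  assumes "\<pi> permutes {..<p}"
  shows "det_nat p (\<lambda>a b. M a (\<pi> b)) = of_int (sign \<pi>) * det_nat p M"
proof -
  have "det_nat p M = (\<Sum>\<sigma> | \<sigma> permutes {..<p}.
      of_int (sign (\<pi> \<circ> \<sigma>)) * (\<Prod>a<p. M a ((\<pi> \<circ> \<sigma>) a)))"
    unfolding det_nat_def by (rule setum_permutations_compose_left[OF assms])
  also have "\<dots> = (\<Sum>\<sigma> | \<sigma> permutes {..<p}.
      of_int (sign \<pi>) * (of_int (sign \<sigma>) * (\<Prod>a<p. M a (\<pi> (\<sigma> a)))))"
    using assms by (intro sum.cong refl)
      (auto simp: sign_compose permutes_imp_permutation[OF finite_lessThan])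
  also have "\<dots> = of_int (sign \<pi>) * det_nat p (\<lambda>a b. M a (\<pi> b))"
    by (simp add: det_nat_def sum_distrib_left)
  finally have "of_int (sign \<pi>) * det_nat p M
      = of_int (sign \<pi> * sign \<pi>) * det_nat p (\<lambda>a b. M a (\<pi> b))" 
    by (simp only: of_int_mult mult.assoc)
  then show ?thesis by simp
qed

lemma det_nat_identical_columns:
  assumes "i < p" "j < p" "i \<noteq> j" "\<And>a. M a i = M a j"
  shows "det_nat p M = 0"
proof -
  have "det_nat p M = det_nat p (\<lambda>a b. M a (Transposition.transpose i j b))"
    using assms(4) by (intro arg_cong[where f="det_nat p"] ext) (auto simp: Transposition.transpose_def)
  also have "\<dots> = - det_nat p M"
    using assms(1-3)
    by (subst det_nat_permute_columns) (auto intro: permutes_swap_id simp: sign_swap_id)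
  finally show ?thesis by simp
qed

text \<open>\<open>YIK\<close> reads its index sets in increasing order, while differentiation
  produces index sequences in arbitrary order. The sequence and the sorted list enumerate the same
  multiset, hence differ by a permutation of positions.\<close>

lemma inj_on_eq_permuted_sorted_list:
  fixes f :: "nat \<Rightarrow> 'a::linorder"
  assumes "inj_on f {..<p}"
  obtains \<pi> where "\<pi> permutes {..<p}"
    "\<And>b. b < p \<Longrightarrow> f b = sorted_list_of_set (f ` {..<p}) ! \<pi> b"
proof -
  let ?l = "sorted_list_of_set (f ` {..<p})"
  have len: "length ?l = p" using assms by (simp add: card_image)
  have "image_mset ((!) ?l) (mset_set {..<p}) = mset (map ((!) ?l) [0..<length ?l])"
    unfolding len by (simp add: lessThan_atLeast0)
  also have "\<dots> = mset ?l" by (simp only: map_nth)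
  also have "\<dots> = mset_set (f ` {..<p})"
    by (subst sorted_list_of_mset_set[symmetric]) (rule mset_sorted_list_of_multiset)
  also have "\<dots> = image_mset f (mset_set {..<p})"
    using assms by (simp add: image_mset_mset_set)
  finally have eq: "image_mset f (mset_set {..<p}) = image_mset ((!) ?l) (mset_set {..<p})"
    by (rule sym)
  obtain \<pi> where "\<pi> permutes {..<p}" "\<forall>b\<in>{..<p}. f b = ?l ! \<pi> b"
    by (rule image_mset_eq_implies_permutes[OF finite_lessThan eq])
  then show thesis using that by blast
qed

section \<open>Arbitrary minors of the fields compared with the entries of \<Lambda>_p\<close>

lemma finite_multi_idx: "finite (multi_idx p q)"
  unfolding multi_idx_def by (rule finite_subset[of _ "Pow {..<q}"]) auto

lemma sorted_list_multi_idx_less: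
  assumes "J \<in> multi_idx p q" "b < p"
  shows "sorted_list_of_set J ! b < q"
proof -
  have "finite J" "card J = p" "J \<subseteq> {..<q}"
    using assms by (auto simp: multi_idx_def intro: finite_subset)
  then show ?thesis
    using assms(2) nth_mem[of b "sorted_list_of_set J"] by auto
qed

lemma YIK_eq_det_nat:
  assumes "J \<in> multi_idx p q"
  shows "YIK g J K =
    (\<lambda>y. det_nat p (\<lambda>a b. g (sorted_list_of_set J ! b) y $ (sorted_list_of_set K ! a)))"
  using assms by (auto simp: YIK_def Let_def multi_idx_def)

lemma abs_le_coef_norm:
  assumes "i < q"
  shows "\<bar>c i\<bar> \<le> coef_norm q c"
proof -
  have "(c i)\<^sup>2 \<le> (\<Sum>i<q. (c i)\<^sup>2)" using assms by (intro member_le_sum) auto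
  then show ?thesis unfolding coef_norm_def by (simp add: real_le_rsqrt)
qed

lemma abs_YIK_le_Lambda_norm:
  assumes "J \<in> multi_idx p q" "K \<in> coord_idx p"
  shows "\<bar>YIK g J K x\<bar> \<le> Lambda_norm q g p x"
proof -
  have "(YIK g J K x)\<^sup>2 \<le> (\<Sum>K\<in>coord_idx p. (YIK g J K x)\<^sup>2)"
    using assms by (intro member_le_sum) auto
  also have "\<dots> \<le> (\<Sum>J\<in>multi_idx p q. \<Sum>K\<in>coord_idx p. (YIK g J K x)\<^sup>2)"
    using assms by (intro member_le_sum[where f="\<lambda>J. \<Sum>K\<in>coord_idx p. (YIK g J K x)\<^sup>2"])
      (auto intro: sum_nonneg finite_multi_idx)
  finally show ?thesis
    unfolding Lambda_norm_def by (simp add: real_le_rsqrt)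
qed

lemma Lambda_norm_nonneg: "0 \<le> Lambda_norm q g p x"
  unfolding Lambda_norm_def by (simp add: sum_nonneg)

text \<open>Up to sign such a determinant is zero (repeated index) or an entry of \<open>\<Lambda>\<^sub>p\<close>.\<close>

lemma abs_minor_le_Lambda_norm:
  fixes ks :: "nat \<Rightarrow> 'n::{finite,linorder}"
  assumes "\<And>b. b < p \<Longrightarrow> js b < q"
  shows "\<bar>det_nat p (\<lambda>a b. g (js b) x $ ks a)\<bar> \<le> Lambda_norm q g p x"
proof (cases "inj_on js {..<p} \<and> inj_on ks {..<p}")
  case True
  define J where "J = js ` {..<p}"
  define K where "K = ks ` {..<p}"
  obtain \<pi> where \<pi>: "\<pi> permutes {..<p}" "\<And>b. b < p \<Longrightarrow> js b = sorted_list_of_set J ! \<pi> b"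
    unfolding J_def using True by (blast intro: inj_on_eq_permuted_sorted_list[of js p])
  obtain \<tau> where \<tau>: "\<tau> permutes {..<p}" "\<And>b. b < p \<Longrightarrow> ks b = sorted_list_of_set K ! \<tau> b"
    unfolding K_def using True by (blast intro: inj_on_eq_permuted_sorted_list[of ks p])
  let ?M = "\<lambda>a b. g (sorted_list_of_set J ! b) x $ (sorted_list_of_set K ! a)"
  have J: "J \<in> multi_idx p q"
    using assms True by (auto simp: multi_idx_def J_def card_image)
  have K: "K \<in> coord_idx p"
    using True by (auto simp: coord_idx_def K_def card_image)
  have "det_nat p (\<lambda>a b. g (js b) x $ ks a) = det_nat p (\<lambda>a b. ?M (\<tau> a) (\<pi> b))"
    by (intro det_nat_cong) (simp add: \<pi> \<tau>)
  also have "\<dots> = of_int (sign \<pi>) * det_nat p (\<lambda>a b. ?M (\<tau> a) b)"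
    by (rule det_nat_permute_columns[OF \<pi>(1)])
  \<comment> \<open>Rows are permuted by transposing, applying the column rule, and transposing
    back.\<close>
  also have "det_nat p (\<lambda>a b. ?M (\<tau> a) b) = det_nat p (\<lambda>a b. ?M (\<tau> b) a)"
    by (rule det_nat_transpose[symmetric])
  also have "\<dots> = of_int (sign \<tau>) * det_nat p (\<lambda>a b. ?M b a)"
    by (rule det_nat_permute_columns[OF \<tau>(1)])
  also have "det_nat p (\<lambda>a b. ?M b a) = det_nat p ?M"
    by (rule det_nat_transpose)
  also have "det_nat p ?M = YIK g J K x"
    by (simp add: YIK_eq_det_nat[OF J])
  finally have "\<bar>det_nat p (\<lambda>a b. g (js b) x $ ks a)\<bar> = \<bar>YIK g J K x\<bar>"
    by (simp add: abs_mult flip: of_int_abs)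
  then show ?thesis
    using abs_YIK_le_Lambda_norm[OF J K, of g x] by simp
next
  case False
  then have "det_nat p (\<lambda>a b. g (js b) x $ ks a) = 0"
  proof (cases "inj_on js {..<p}")
    case True
    then obtain i j where "i < p" "j < p" "i \<noteq> j" "ks i = ks j"
      using False by (auto simp: inj_on_def)
    then have "det_nat p (\<lambda>a b. g (js a) x $ ks b) = 0"
      by (intro det_nat_identical_columns[of i p j]) auto
    then show ?thesis
      using det_nat_transpose[of p "\<lambda>a b. g (js b) x $ ks a"] by simp
  next
    case False
    then obtain i j where "i < p" "j < p" "i \<noteq> j" "js i = js j"
      by (auto simp: inj_on_def)
    then show ?thesis
      by (intro det_nat_identical_columns[of i p j]) auto
  qed
  then show ?thesis by (simp add: Lambda_norm_nonneg)
qed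

subsection \<open>Derivatives of minors\<close>

text \<open>This is the differential of the determinant at the matrix \<open>M\<close> in the
  direction \<open>N\<close>. Keeping it as the product rule applied to the Leibniz expansion avoids
  any invertibility assumption on \<open>M\<close>.\<close>

definition det_nat_diff :: "nat \<Rightarrow> (nat \<Rightarrow> nat \<Rightarrow> real) \<Rightarrow> (nat \<Rightarrow> nat \<Rightarrow> real) \<Rightarrow> real" where
  "det_nat_diff p M N = (\<Sum>\<sigma> | \<sigma> permutes {..<p}.
     of_int (sign \<sigma>) * (\<Sum>a<p. N a (\<sigma> a) * (\<Prod>i\<in>{..<p}-{a}. M i (\<sigma> i))))"

lemma has_derivative_det_nat:
  assumes "\<And>a b. a < p \<Longrightarrow> b < p \<Longrightarrow> (M a b has_derivative M' a b) (at x within S)"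
  shows "((\<lambda>x. det_nat p (\<lambda>a b. M a b x)) has_derivative
     (\<lambda>v. det_nat_diff p (\<lambda>a b. M a b x) (\<lambda>a b. M' a b v))) (at x within S)"
  unfolding det_nat_def det_nat_diff_def
proof (intro has_derivative_sum has_derivative_mult_right has_derivative_prod)
  fix \<sigma> :: "nat \<Rightarrow> nat" and a assume "\<sigma> \<in> {\<sigma>. \<sigma> permutes {..<p}}" "a \<in> {..<p}"
  then have "\<sigma> a < p" using permutes_in_image[of \<sigma> "{..<p}" a] by simp
  then show "(M a (\<sigma> a) has_derivative M' a (\<sigma> a)) (at x within S)"
    using assms \<open>a \<in> {..<p}\<close> by simp
qed

lemma det_nat_diff_add:
  "det_nat_diff p M (\<lambda>a b. N a b + N' a b) = det_nat_diff p M N + det_nat_diff p M N'"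
  by (simp add: det_nat_diff_def sum.distrib algebra_simps)

lemma det_nat_diff_cong:
  assumes "\<And>a b. a < p \<Longrightarrow> b < p \<Longrightarrow> N a b = N' a b"
  shows "det_nat_diff p M N = det_nat_diff p M N'"
  unfolding det_nat_diff_def
proof (intro sum.cong refl arg_cong2[where f="(*)"])
  fix \<sigma> :: "nat \<Rightarrow> nat" and a assume "\<sigma> \<in> {\<sigma>. \<sigma> permutes {..<p}}" "a \<in> {..<p}"
  then show "N a (\<sigma> a) = N' a (\<sigma> a)"
    using permutes_in_image[of \<sigma> "{..<p}" a] assms by simp
qed

text \<open>Passing to the inverse permutation moves the differentiated factor from position
  \<open>a\<close> to position \<open>\<sigma> a\<close>. The lemma lets combinations of columns be
  treated by the rule for combinations of rows.\<close>

lemma det_nat_diff_transpose: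
  "det_nat_diff p (\<lambda>a b. M b a) (\<lambda>a b. N b a) = det_nat_diff p M N"
proof -
  have "det_nat_diff p (\<lambda>a b. M b a) (\<lambda>a b. N b a) =
      (\<Sum>\<sigma> | \<sigma> permutes {..<p}. of_int (sign (inv \<sigma>)) *
        (\<Sum>a<p. N (inv \<sigma> a) a * (\<Prod>i\<in>{..<p}-{a}. M (inv \<sigma> i) i)))"
    unfolding det_nat_diff_def by (rule sum_permutations_inverse)
  also have "\<dots> = det_nat_diff p M N"
    unfolding det_nat_diff_def
  proof (rule sum.cong[OF refl], rule arg_cong2[where f="(*)"])
    fix \<sigma> :: "nat \<Rightarrow> nat" assume "\<sigma> \<in> {\<sigma>. \<sigma> permutes {..<p}}"
    then have s: "\<sigma> permutes {..<p}" by simp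
    show "of_int (sign (inv \<sigma>)) = (of_int (sign \<sigma>) :: real)"
      using s by (simp add: sign_inverse permutes_imp_permutation[OF finite_lessThan])
    have *: "(\<Prod>i\<in>{..<p}-{\<sigma> a}. M (inv \<sigma> i) i) = (\<Prod>i\<in>{..<p}-{a}. M i (\<sigma> i))" if "a < p" for a
    proof -
      have "bij_betw \<sigma> ({..<p}-{a}) ({..<p}-{\<sigma> a})"
        using s that permutes_in_image[OF s, of a]
        by (intro bij_betw_DiffI) (auto simp: permutes_imp_bij)
      from prod.reindex_bij_betw[OF this, of "\<lambda>i. M (inv \<sigma> i) i"] show ?thesis
        using s by (simp add: permutes_inverses)
    qed
    have "(\<Sum>a<p. N (inv \<sigma> a) a * (\<Prod>i\<in>{..<p}-{a}. M (inv \<sigma> i) i))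
        = (\<Sum>a<p. N (inv \<sigma> (\<sigma> a)) (\<sigma> a) * (\<Prod>i\<in>{..<p}-{\<sigma> a}. M (inv \<sigma> i) i))"
      using s by (intro sum.reindex_bij_betw[symmetric] permutes_imp_bij)
    then show "(\<Sum>a<p. N (inv \<sigma> a) a * (\<Prod>i\<in>{..<p}-{a}. M (inv \<sigma> i) i))
        = (\<Sum>a<p. N a (\<sigma> a) * (\<Prod>i\<in>{..<p}-{a}. M i (\<sigma> i)))"
      using s * by (simp add: permutes_inverses)
  qed
  finally show ?thesis .
qed

text \<open>By multilinearity the differential is the sum of the determinants in which one row of
  \<open>M\<close> gives way to the corresponding row of the direction. Expanding that row in the
  \<open>R m\<close> leaves only determinants with a row \<open>R m\<close> inserted, and these will
  be minors of the fields again.\<close>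

lemma det_nat_diff_row_combination:
  "det_nat_diff p M (\<lambda>a b. \<Sum>m\<in>S. c a m * R m b)
     = (\<Sum>a<p. \<Sum>m\<in>S. c a m * det_nat p (\<lambda>i b. if i = a then R m b else M i b))"
proof -
  have prod: "(\<Prod>i<p. if i = a then R m (\<sigma> i) else M i (\<sigma> i)) = R m (\<sigma> a) * (\<Prod>i\<in>{..<p}-{a}. M i (\<sigma> i))"
    if "a < p" for a m \<sigma>
    using that by (subst prod.remove[of _ a]) auto
  have "(\<Sum>a<p. \<Sum>m\<in>S. c a m * det_nat p (\<lambda>i b. if i = a then R m b else M i b))
      = (\<Sum>a<p. \<Sum>m\<in>S. \<Sum>\<sigma> | \<sigma> permutes {..<p}.
          of_int (sign \<sigma>) * (c a m * R m (\<sigma> a) * (\<Prod>i\<in>{..<p}-{a}. M i (\<sigma> i))))"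
    unfolding det_nat_def by (simp add: prod sum_distrib_left mult_ac)
  also have "\<dots> = (\<Sum>a<p. \<Sum>\<sigma> | \<sigma> permutes {..<p}. \<Sum>m\<in>S.
          of_int (sign \<sigma>) * (c a m * R m (\<sigma> a) * (\<Prod>i\<in>{..<p}-{a}. M i (\<sigma> i))))"
    by (intro sum.cong refl sum.swap)
  also have "\<dots> = (\<Sum>\<sigma> | \<sigma> permutes {..<p}. \<Sum>a<p. \<Sum>m\<in>S.
          of_int (sign \<sigma>) * (c a m * R m (\<sigma> a) * (\<Prod>i\<in>{..<p}-{a}. M i (\<sigma> i))))"
    by (rule sum.swap)
  finally show ?thesis
    by (simp add: det_nat_diff_def sum_distrib_left sum_distrib_right)
qed

text \<open>A crude count: p! permutations, p choices of the differentiated factor, and p - 1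
  undifferentiated factors. It does not see \<Lambda>_p, so it serves only for terms that carry a
  factor |h|.\<close>

lemma abs_det_nat_diff_le:
  assumes "\<And>a b. a < p \<Longrightarrow> b < p \<Longrightarrow> \<bar>M a b\<bar> \<le> B"
    and "\<And>a b. a < p \<Longrightarrow> b < p \<Longrightarrow> \<bar>N a b\<bar> \<le> w"
  shows "\<bar>det_nat_diff p M N\<bar> \<le> fact p * real p * B ^ (p - 1) * w"
proof -
  have "\<bar>det_nat_diff p M N\<bar> \<le> (\<Sum>\<sigma> | \<sigma> permutes {..<p}. \<Sum>a<p. w * B ^ (p - 1))"
    unfolding det_nat_diff_def
  proof (rule order.trans[OF sum_abs], rule sum_mono)
    fix \<sigma> :: "nat \<Rightarrow> nat" assume "\<sigma> \<in> {\<sigma>. \<sigma> permutes {..<p}}"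
    then have s: "\<sigma> i < p" if "i < p" for i using that by (auto dest: permutes_in_image)
    have "\<bar>\<Sum>a<p. N a (\<sigma> a) * (\<Prod>i\<in>{..<p}-{a}. M i (\<sigma> i))\<bar> \<le> (\<Sum>a<p. w * B ^ (p - 1))"
    proof (rule order.trans[OF sum_abs], rule sum_mono)
      fix a assume "a \<in> {..<p}"
      then have a: "a < p" by simp
      have "\<bar>\<Prod>i\<in>{..<p}-{a}. M i (\<sigma> i)\<bar> \<le> (\<Prod>i\<in>{..<p}-{a}. B)"
        unfolding abs_prod using s assms(1) by (intro prod_mono) auto
      also have "\<dots> = B ^ (p - 1)" using a by simp
      finally show "\<bar>N a (\<sigma> a) * (\<Prod>i\<in>{..<p}-{a}. M i (\<sigma> i))\<bar> \<le> w * B ^ (p - 1)"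
        unfolding abs_mult using assms(2)[OF a s[OF a]] by (intro mult_mono) auto
    qed
    then show "\<bar>of_int (sign \<sigma>) * (\<Sum>a<p. N a (\<sigma> a) * (\<Prod>i\<in>{..<p}-{a}. M i (\<sigma> i)))\<bar> \<le> (\<Sum>a<p. w * B ^ (p - 1))"
      by (simp add: abs_mult flip: of_int_abs)
  qed
  also have "\<dots> = real (card {\<sigma>. \<sigma> permutes {..<p}}) * (p * (w * B ^ (p - 1)))"
    by simp
  also have "card {\<sigma>. \<sigma> permutes {..<p}} = fact p"
    by (rule card_permutations) auto
  finally show ?thesis by (simp only: of_nat_fact mult_ac)
qed

text \<open>The term \<open>Dg\<^sub>k g\<^sub>j\<close> is a fixed matrix applied to all columns, hence acts by combining rows; the
  bracket term combines columns. Both only produce further minors.\<close>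

lemma YIK_has_bounded_derivative:
  fixes g :: "nat \<Rightarrow> real^('n::{finite,linorder}) \<Rightarrow> real^('n::{finite,linorder})"
    and L B C :: real
  assumes J: "J \<in> multi_idx p q" and K: "K \<in> coord_idx p"
    and D: "\<And>j. j < q \<Longrightarrow> (g j has_derivative D j) (at x)"
    and DL: "\<And>j v. j < q \<Longrightarrow> norm (D j v) \<le> L * norm v"
    and gB: "\<And>j. j < q \<Longrightarrow> norm (g j x) \<le> B"
    and bracket: "\<And>j k. j < q \<Longrightarrow> k < q \<Longrightarrow> \<exists>c. coef_norm q c \<le> C \<and>
        D k (g j x) - D j (g k x) = (\<Sum>i<q. c i *\<^sub>R g i x)"
  obtains Df where "(YIK g J K has_derivative Df) (at x)"
    "\<And>w. \<bar>Df w\<bar> \<le> fact p * real p * B ^ (p - 1) * (L * norm w)"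
    "\<And>k. k < q \<Longrightarrow> \<bar>Df (g k x)\<bar> \<le> (real p * real CARD('n) * L + real p * real q * C) * Lambda_norm q g p x"
proof -
  define js where "js = (!) (sorted_list_of_set J)"
  define ks where "ks = (!) (sorted_list_of_set K)"
  have js: "js b < q" if "b < p" for b
    using sorted_list_multi_idx_less[OF J that] by (simp add: js_def)
  define M where "M a b = g (js b) x $ ks a" for a b
  define Df where "Df v = det_nat_diff p M (\<lambda>a b. D (js b) v $ ks a)" for v
  have YIK: "YIK g J K = (\<lambda>y. det_nat p (\<lambda>a b. g (js b) y $ ks a))"
    unfolding js_def ks_def by (rule YIK_eq_det_nat[OF J])
  have "(YIK g J K has_derivative Df) (at x)"
    unfolding YIK Df_def M_def
  proof (rule has_derivative_det_nat)
    fix a b assume "b < p"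
    show "((\<lambda>y. g (js b) y $ ks a) has_derivative (\<lambda>v. D (js b) v $ ks a)) (at x)"
      by (rule bounded_linear.has_derivative[OF bounded_linear_vec_nth D[OF js[OF \<open>b < p\<close>]]])
  qed
  moreover have "\<bar>Df w\<bar> \<le> fact p * real p * B ^ (p - 1) * (L * norm w)" for w
    unfolding Df_def
  proof (rule abs_det_nat_diff_le)
    fix a b assume "b < p"
    show "\<bar>M a b\<bar> \<le> B"
      unfolding M_def by (rule order.trans[OF component_le_norm_cart gB[OF js[OF \<open>b < p\<close>]]])
    show "\<bar>D (js b) w $ ks a\<bar> \<le> L * norm w"
      by (rule order.trans[OF component_le_norm_cart DL[OF js[OF \<open>b < p\<close>]]])
  qed
  moreover have "\<bar>Df (g k x)\<bar> \<le> (real p * real CARD('n) * L + real p * real q * C) * Lambda_norm q g p x"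
    if k: "k < q" for k
  proof -
    let ?N = "Lambda_norm q g p x"
    have N0: "0 \<le> ?N" by (rule Lambda_norm_nonneg)
    have "\<exists>c. \<forall>j<q. coef_norm q (c j) \<le> C \<and>
        D j (g k x) - D k (g j x) = (\<Sum>i<q. c j i *\<^sub>R g i x)"
      using bracket[OF k] by metis
    then obtain c where c: "\<And>j. j < q \<Longrightarrow> coef_norm q (c j) \<le> C"
        "\<And>j. j < q \<Longrightarrow> D j (g k x) - D k (g j x) = (\<Sum>i<q. c j i *\<^sub>R g i x)"
      by blast
    have cC: "\<bar>c j i\<bar> \<le> C" if "j < q" "i < q" for i j
      using abs_le_coef_norm[OF that(2), of "c j"] c(1)[OF that(1)] by simp
    \<comment> \<open>The matrix of \<open>D k\<close> in the standard basis. Its entries inherit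
      the bound \<open>L\<close> because basis vectors have norm one.\<close>
    define A where "A r m = D k (axis m 1) $ r" for r m
    have AL: "\<bar>A r m\<bar> \<le> L" for r m
      using DL[OF k, of "axis m 1"] component_le_norm_cart[of "D k (axis m 1)" r]
      by (simp add: A_def norm_axis_1)
    have L0: "0 \<le> L" by (rule order.trans[OF abs_ge_zero AL])
    have C0: "0 \<le> C" by (rule order.trans[OF abs_ge_zero cC[OF k k]])
    have Dk: "D k v $ r = (\<Sum>m\<in>UNIV. A r m * v $ m)" for v r
    proof -
      have "linear (D k)" using D[OF k] has_derivative_linear by blast
      then have "D k v = (\<Sum>m\<in>UNIV. v $ m *\<^sub>R D k (axis m 1))"
        by (subst basis_expansion[of v, symmetric]) (simp add: linear_sum linear_scale scalar_mult_eq_scaleR)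
      then show ?thesis by (simp add: A_def mult.commute)
    qed
    have "Df (g k x) = det_nat_diff p M (\<lambda>a b. (\<Sum>m\<in>UNIV. A (ks a) m * g (js b) x $ m)
         + (\<Sum>i<q. c (js b) i * g i x $ ks a))"
      unfolding Df_def
    proof (rule det_nat_diff_cong)
      fix a b assume "a < p" "b < p"
      have "D (js b) (g k x) = D k (g (js b) x) + (\<Sum>i<q. c (js b) i *\<^sub>R g i x)"
        using c(2)[OF js[OF \<open>b < p\<close>]] by (simp add: algebra_simps)
      then show "D (js b) (g k x) $ ks a = (\<Sum>m\<in>UNIV. A (ks a) m * g (js b) x $ m)
         + (\<Sum>i<q. c (js b) i * g i x $ ks a)"
        by (simp add: Dk)
    qed
    also have "\<dots> = det_nat_diff p M (\<lambda>a b. \<Sum>m\<in>UNIV. A (ks a) m * g (js b) x $ m)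
        + det_nat_diff p M (\<lambda>a b. \<Sum>i<q. c (js b) i * g i x $ ks a)"
      by (rule det_nat_diff_add)
    also have "det_nat_diff p M (\<lambda>a b. \<Sum>m\<in>UNIV. A (ks a) m * g (js b) x $ m)
        = (\<Sum>a<p. \<Sum>m\<in>UNIV. A (ks a) m * det_nat p (\<lambda>i b. if i = a then g (js b) x $ m else M i b))"
      by (rule det_nat_diff_row_combination)
    \<comment> \<open>The bracket term combines columns; transposing turns it into a combination of
      rows.\<close>
    also have "det_nat_diff p M (\<lambda>a b. \<Sum>i<q. c (js b) i * g i x $ ks a)
        = det_nat_diff p (\<lambda>a b. M b a) (\<lambda>a b. \<Sum>i<q. c (js a) i * g i x $ ks b)"
      by (rule det_nat_diff_transpose[symmetric])
    also have "\<dots> = (\<Sum>a<p. \<Sum>i<q. c (js a) i *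
        det_nat p (\<lambda>j b. if j = a then g i x $ ks b else M b j))"
      by (rule det_nat_diff_row_combination)
    finally have eq: "Df (g k x) =
      (\<Sum>a<p. \<Sum>m\<in>UNIV. A (ks a) m * det_nat p (\<lambda>i b. if i = a then g (js b) x $ m else M i b))
      + (\<Sum>a<p. \<Sum>i<q. c (js a) i * det_nat p (\<lambda>j b. if j = a then g i x $ ks b else M b j))" .
    \<comment> \<open>Replacing row \<open>a\<close> amounts to changing one coordinate index, to
      \<open>ks(a := m)\<close>; below, replacing a column changes one field index, to
      \<open>js(a := i)\<close>. The new sequence may be unordered or have repetitions, which the
      bound for arbitrary minors allows.\<close>
    have row: "\<bar>det_nat p (\<lambda>i b. if i = a then g (js b) x $ m else M i b)\<bar> \<le> ?N" for a m
    proof -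
      have "(\<lambda>i b. if i = a then g (js b) x $ m else M i b) = (\<lambda>i b. g (js b) x $ (ks(a := m)) i)"
        by (auto simp: M_def fun_eq_iff)
      then show ?thesis using abs_minor_le_Lambda_norm[of p js q g x "ks(a := m)"] js by simp
    qed
    have col: "\<bar>det_nat p (\<lambda>j b. if j = a then g i x $ ks b else M b j)\<bar> \<le> ?N" if "i < q" for a i
    proof -
      have "(\<lambda>j b. if j = a then g i x $ ks b else M b j) = (\<lambda>j b. g ((js(a := i)) j) x $ ks b)"
        by (auto simp: M_def fun_eq_iff)
      then have "det_nat p (\<lambda>j b. if j = a then g i x $ ks b else M b j)
          = det_nat p (\<lambda>b j. g ((js(a := i)) j) x $ ks b)"
        using det_nat_transpose[of p "\<lambda>b j. g ((js(a := i)) j) x $ ks b"] by simp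
      then show ?thesis
        using abs_minor_le_Lambda_norm[of p "js(a := i)" q g x ks] js that by simp
    qed
    have "\<bar>\<Sum>a<p. \<Sum>m\<in>UNIV. A (ks a) m * det_nat p (\<lambda>i b. if i = a then g (js b) x $ m else M i b)\<bar>
        \<le> (\<Sum>a<p. \<Sum>m\<in>(UNIV::'n set). L * ?N)"
      by (intro order.trans[OF sum_abs] sum_mono, unfold abs_mult)
        (intro mult_mono AL row L0 abs_ge_zero)
    moreover have "\<bar>\<Sum>a<p. \<Sum>i<q. c (js a) i * det_nat p (\<lambda>j b. if j = a then g i x $ ks b else M b j)\<bar>
        \<le> (\<Sum>a<p. \<Sum>i<q. C * ?N)"
      by (intro order.trans[OF sum_abs] sum_mono, unfold abs_mult)
        (intro mult_mono cC col C0 abs_ge_zero js; simp)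
    ultimately have "\<bar>Df (g k x)\<bar> \<le> (\<Sum>a<p. \<Sum>m\<in>(UNIV::'n set). L * ?N) + (\<Sum>a<p. \<Sum>i<q. C * ?N)"
      unfolding eq by linarith
    also have "\<dots> = (real p * real CARD('n) * L + real p * real q * C) * ?N"
      by (simp add: distrib_right)
    finally show ?thesis .
  qed
  ultimately show thesis by (rule that[of Df])
qed

subsection \<open>Lipschitz functions\<close>

lemma locally_lipschitz_imp_lipschitz_on_compact:
  fixes f :: "'a::metric_space \<Rightarrow> 'b::metric_space"
  assumes "locally_lipschitz f" "compact X"
  obtains L where "L-lipschitz_on X f"
proof -
  \<comment> \<open>The notion for time-dependent maps is used with the single time 0, so that its
    compactness theorem supplies one constant on all of \<open>X\<close>.\<close>
  have "local_lipschitz {0::real} X (\<lambda>_. f)"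
  proof (rule local_lipschitzI)
    fix x
    obtain e L where "e > 0" "L-lipschitz_on (ball x e) f"
      using assms(1) unfolding locally_lipschitz_def by blast
    then have "L-lipschitz_on (cball x (e/2) \<inter> X) f"
      by (elim lipschitz_on_subset) auto
    then show "\<exists>u>0. \<exists>L. \<forall>t\<in>cball t u \<inter> {0}. L-lipschitz_on (cball x u \<inter> X) f" for t :: real
      using \<open>e > 0\<close> by (intro exI[of _ "e/2"]) auto
  qed
  from local_lipschitz_compact_implies_lipschitz[OF this assms(2) compact_sing]
  show thesis using that by auto
qed

lemma locally_lipschitz_imp_continuous_on:
  assumes "locally_lipschitz f"
  shows "continuous_on S f"
proof (rule continuous_at_imp_continuous_on, rule ballI)
  fix x
  obtain e L where "e > 0" "L-lipschitz_on (ball x e) f"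
    using assms unfolding locally_lipschitz_def by blast
  then show "isCont f x"
    using lipschitz_on_continuous_on continuous_on_eq_continuous_at[OF open_ball, of x e f] by auto
qed

lemma finite_family_locally_lipschitz_on_compact:
  fixes g :: "nat \<Rightarrow> 'a::metric_space \<Rightarrow> 'b::real_normed_vector"
  assumes g: "\<And>j. j < q \<Longrightarrow> locally_lipschitz (g j)" and X: "compact X"
  obtains L B where "0 \<le> L" "\<And>j. j < q \<Longrightarrow> L-lipschitz_on X (g j)"
    "0 \<le> B" "\<And>j x. j < q \<Longrightarrow> x \<in> X \<Longrightarrow> norm (g j x) \<le> B"
proof -
  have "\<exists>L. L-lipschitz_on X (g j)" if "j < q" for j
    by (rule locally_lipschitz_imp_lipschitz_on_compact[OF g[OF that] X]) (rule exI)
  then obtain l :: "nat \<Rightarrow> real" where l: "\<And>j. j < q \<Longrightarrow> (l j)-lipschitz_on X (g j)" by metis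
  have "\<exists>B. \<forall>x\<in>X. norm (g j x) \<le> B" if "j < q" for j
    using compact_imp_bounded[OF compact_continuous_image[OF
          locally_lipschitz_imp_continuous_on[OF g[OF that]] X]]
    by (auto simp: bounded_iff)
  then obtain b where b: "\<And>j x. j < q \<Longrightarrow> x \<in> X \<Longrightarrow> norm (g j x) \<le> b j" by metis
  \<comment> \<open>The sum of absolute values acts as a common upper bound and, unlike a maximum,
    needs no separate case for q = 0.\<close>
  have le_sum: "f j \<le> (\<Sum>j<q. \<bar>f j\<bar>)" if "j < q" for f :: "nat \<Rightarrow> real" and j
  proof -
    have "\<bar>f j\<bar> \<le> (\<Sum>j<q. \<bar>f j\<bar>)" using that by (intro member_le_sum) auto
    then show ?thesis by simp
  qed
  show thesis
  proof (rule that[of "\<Sum>j<q. \<bar>l j\<bar>" "\<Sum>j<q. \<bar>b j\<bar>"])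
    show "(\<Sum>j<q. \<bar>l j\<bar>)-lipschitz_on X (g j)" if "j < q" for j
      by (rule lipschitz_on_le[OF l[OF that] le_sum[OF that, of l]])
    show "norm (g j x) \<le> (\<Sum>j<q. \<bar>b j\<bar>)" if "j < q" "x \<in> X" for j x
      by (rule order.trans[OF b[OF that] le_sum[OF that(1), of b]])
  qed (auto intro: sum_nonneg)
qed

lemma norm_has_derivative_le_lipschitz:
  fixes f :: "'a::real_normed_vector \<Rightarrow> 'b::real_normed_vector"
  assumes D: "(f has_derivative D) (at x)" and S: "open S" "x \<in> S" and lip: "L-lipschitz_on S f"
  shows "norm (D v) \<le> L * norm v"
proof (cases "v = 0")
  case True
  then show ?thesis using has_derivative_bounded_linear[OF D] by (simp add: linear_simps)
next
  case False
  show ?thesis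
  proof (rule field_le_epsilon)
    fix e :: real assume "e > 0"
    define e' where "e' = e / norm v"
    have "e' > 0" using \<open>e > 0\<close> False by (simp add: e'_def)
    then obtain d where d: "d > 0" "\<And>y. norm (y - x) < d \<Longrightarrow> norm (f y - f x - D (y - x)) \<le> e' * norm (y - x)"
      using D unfolding has_derivative_at_alt by blast
    obtain r where r: "r > 0" "ball x r \<subseteq> S" using S open_contains_ball by blast
    define h where "h = min d r / (2 * norm v)"
    have h: "h > 0" "h * norm v < d" "h * norm v < r"
      using d(1) r(1) False by (auto simp: h_def)
    have lin: "D (h *\<^sub>R v) = h *\<^sub>R D v"
      using has_derivative_bounded_linear[OF D] by (simp add: linear_simps)
    have y: "x + h *\<^sub>R v \<in> S" using r h by (auto simp: dist_norm subset_iff)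
    have "h * norm (D v) = norm (D (h *\<^sub>R v))" using lin h by simp
    also have "\<dots> \<le> norm (f (x + h *\<^sub>R v) - f x) + norm (f (x + h *\<^sub>R v) - f x - D (h *\<^sub>R v))"
      using norm_triangle_ineq4[of "f (x + h *\<^sub>R v) - f x" "f (x + h *\<^sub>R v) - f x - D (h *\<^sub>R v)"] by simp
    also have "\<dots> \<le> L * (h * norm v) + e' * (h * norm v)"
      using lipschitz_onD[OF lip y S(2)] d(2)[of "x + h *\<^sub>R v"] h
      by (intro add_mono) (auto simp: dist_norm)
    also have "\<dots> = h * (L * norm v + e)"
      using False by (simp add: e'_def algebra_simps)
    finally show "norm (D v) \<le> L * norm v + e" using h(1) by simp
  qed
qed

text \<open>A product of Lipschitz functions is Lipschitz once both factors are bounded; compactness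
  provides the bounds.\<close>

lemma lipschitz_on_mult_compact:
  fixes f g :: "'a::metric_space \<Rightarrow> real"
  assumes S: "compact S" and f: "A-lipschitz_on S f" and g: "B-lipschitz_on S g"
  obtains L where "L-lipschitz_on S (\<lambda>x. f x * g x)"
proof -
  obtain F where F: "\<And>x. x \<in> S \<Longrightarrow> \<bar>f x\<bar> \<le> F"
    using compact_imp_bounded[OF compact_continuous_image[OF lipschitz_on_continuous_on[OF f] S]]
    unfolding bounded_real by auto
  obtain G where G: "\<And>x. x \<in> S \<Longrightarrow> \<bar>g x\<bar> \<le> G"
    using compact_imp_bounded[OF compact_continuous_image[OF lipschitz_on_continuous_on[OF g] S]]
    unfolding bounded_real by auto
  have "(\<bar>F\<bar> * B + A * \<bar>G\<bar>)-lipschitz_on S (\<lambda>x. f x * g x)"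
  proof (rule lipschitz_onI)
    fix x y assume xy: "x \<in> S" "y \<in> S"
    have "f x * g x - f y * g y = f x * (g x - g y) + (f x - f y) * g y"
      by (simp add: algebra_simps)
    then have "dist (f x * g x) (f y * g y) \<le> \<bar>f x\<bar> * \<bar>g x - g y\<bar> + \<bar>f x - f y\<bar> * \<bar>g y\<bar>"
      by (metis abs_mult abs_triangle_ineq dist_real_def)
    also have "\<dots> \<le> \<bar>F\<bar> * (B * dist x y) + (A * dist x y) * \<bar>G\<bar>"
      using lipschitz_onD[OF f xy] lipschitz_onD[OF g xy] F[OF xy(1)] G[OF xy(2)]
        lipschitz_on_nonneg[OF f]
      by (intro add_mono mult_mono) (auto simp: dist_real_def)
    finally show "dist (f x * g x) (f y * g y) \<le> (\<bar>F\<bar> * B + A * \<bar>G\<bar>) * dist x y"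
      by (simp add: algebra_simps)
  next
    show "0 \<le> \<bar>F\<bar> * B + A * \<bar>G\<bar>"
      using lipschitz_on_nonneg[OF f] lipschitz_on_nonneg[OF g] by simp
  qed
  then show thesis by (rule that)
qed

lemma lipschitz_on_prod_compact:
  fixes f :: "'i \<Rightarrow> 'a::metric_space \<Rightarrow> real"
  assumes "compact S" "finite I" "\<And>i. i \<in> I \<Longrightarrow> \<exists>L. L-lipschitz_on S (f i)"
  shows "\<exists>L. L-lipschitz_on S (\<lambda>x. \<Prod>i\<in>I. f i x)"
  using assms(2,3)
proof (induction I rule: finite_induct)
  case empty
  show ?case using lipschitz_on_constant by (auto intro: exI[of _ 0])
next
  case (insert i I)
  then obtain A B where "A-lipschitz_on S (f i)" "B-lipschitz_on S (\<lambda>x. \<Prod>i\<in>I. f i x)"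
    by blast
  from lipschitz_on_mult_compact[OF assms(1) this] show ?case
    using insert(1,2) by (metis (no_types, lifting) ext prod.insert)
qed

lemma lipschitz_on_sum:
  fixes f :: "'i \<Rightarrow> 'a::metric_space \<Rightarrow> 'b::real_normed_vector"
  assumes "finite I" "\<And>i. i \<in> I \<Longrightarrow> \<exists>L. L-lipschitz_on S (f i)"
  shows "\<exists>L. L-lipschitz_on S (\<lambda>x. \<Sum>i\<in>I. f i x)"
  using assms
proof (induction I rule: finite_induct)
  case empty
  show ?case using lipschitz_on_constant by (auto intro: exI[of _ 0])
next
  case (insert i I)
  then obtain A B where "A-lipschitz_on S (f i)" "B-lipschitz_on S (\<lambda>x. \<Sum>i\<in>I. f i x)"
    by blast
  from lipschitz_on_add[OF this] show ?case using insert(1,2) by auto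
qed

lemma lipschitz_on_det_nat:
  assumes "compact S" "\<And>a b. a < p \<Longrightarrow> b < p \<Longrightarrow> \<exists>L. L-lipschitz_on S (M a b)"
  shows "\<exists>L. L-lipschitz_on S (\<lambda>x. det_nat p (\<lambda>a b. M a b x))"
  unfolding det_nat_def
proof (rule lipschitz_on_sum)
  show "finite {\<sigma>. \<sigma> permutes {..<p}}" by (simp add: finite_permutations)
  fix \<sigma> :: "nat \<Rightarrow> nat" assume \<sigma>: "\<sigma> \<in> {\<sigma>. \<sigma> permutes {..<p}}"
  have "\<exists>L. L-lipschitz_on S (\<lambda>x. \<Prod>a<p. M a (\<sigma> a) x)"
  proof (rule lipschitz_on_prod_compact[OF assms(1) finite_lessThan])
    fix a assume "a \<in> {..<p}"
    then show "\<exists>L. L-lipschitz_on S (M a (\<sigma> a))"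
      using \<sigma> permutes_in_image[of \<sigma> "{..<p}" a] assms(2) by simp
  qed
  then show "\<exists>L. L-lipschitz_on S (\<lambda>x. of_int (sign \<sigma>) * (\<Prod>a<p. M a (\<sigma> a) x))"
    using lipschitz_on_cmult_real by blast
qed

text \<open>The exceptional null set is covered by an open set \<open>U\<close> of measure less than \<open>\<epsilon>\<close>; there the
  Lipschitz bound is charged to the function \<open>t \<mapsto> |U \<inter> [s,t]|\<close>, which has slope one on \<open>U\<close>.\<close>

lemma lipschitz_mean_value_inequality_ae:
  fixes F :: "real \<Rightarrow> 'a::real_normed_vector" and B b :: "real \<Rightarrow> real"
  assumes "s \<le> t" and lip: "L-lipschitz_on {s..t} F"
    and B: "\<And>x. x \<in> {s..t} \<Longrightarrow> (B has_real_derivative b x) (at x within {s..t})"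
    and b: "\<And>x. x \<in> {s..t} \<Longrightarrow> 0 \<le> b x"
    and ae: "AE x in lborel. x \<in> {s..t} \<longrightarrow>
      (\<exists>d. (F has_vector_derivative d) (at x within {s..t}) \<and> norm d \<le> b x)"
  shows "norm (F t - F s) \<le> B t - B s"
proof (rule field_le_epsilon)
  fix e :: real assume "e > 0"
  \<comment> \<open>Chosen so that the accumulated error 2\<epsilon>(t - s) + L\<epsilon> is at most
    e; the summand 1 keeps the denominator positive.\<close>
  define \<epsilon> where "\<epsilon> = e / (2 * (t - s) + L + 1)"
  have L0: "0 \<le> L" using lip by (rule lipschitz_on_nonneg)
  have \<epsilon>: "\<epsilon> > 0" using \<open>e > 0\<close> \<open>s \<le> t\<close> L0 by (simp add: \<epsilon>_def)
  obtain N where N: "N \<in> null_sets lborel" "{x \<in> space lborel. \<not> (x \<in> {s..t} \<longrightarrow>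
        (\<exists>d. (F has_vector_derivative d) (at x within {s..t}) \<and> norm d \<le> b x))} \<subseteq> N"
    using ae unfolding eventually_ae_filter by blast
  have Nl: "N \<in> null_sets lebesgue" using N(1) by (rule null_sets_completionI)
  obtain U where U: "open U" "N \<subseteq> U" "emeasure lebesgue (U - N) < ennreal \<epsilon>"
    using sets_lebesgue_outer_open[of N \<epsilon>] Nl \<epsilon> by blast
  have "emeasure lebesgue U < ennreal \<epsilon>"
    using emeasure_Diff_null_set[OF Nl, of U] U by (simp add: borel_open)
  define m where "m x = measure lborel (U \<inter> {s..x})" for x
  have mU: "m x \<le> \<epsilon>" for x
  proof -
    have "emeasure lborel (U \<inter> {s..x}) \<le> emeasure lborel U"
      using U(1) by (intro emeasure_mono) (auto simp: borel_open)
    also have "\<dots> < ennreal \<epsilon>"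
      using \<open>emeasure lebesgue U < ennreal \<epsilon>\<close> U(1) by (simp add: borel_open)
    finally show ?thesis
      unfolding m_def measure_def using \<epsilon> by (simp add: enn2real_leI)
  qed
  have fm: "U \<inter> {x..y} \<in> fmeasurable lborel" for x y :: real
    using U(1) by (subst Int_commute, intro fmeasurable_Int_fmeasurable)
      (auto simp: borel_open fmeasurable_def emeasure_lborel_Icc_eq)
  have m_mono: "m x \<le> m y" if "x \<le> y" for x y
    unfolding m_def using that fm U(1) by (intro measure_mono_fmeasurable) (auto simp: borel_open)
  have m_inc: "m y - m x = y - x" if "s \<le> x" "x \<le> y" "{x..y} \<subseteq> U" for x y
  proof -
    have "U \<inter> {s..y} = (U \<inter> {s..x}) \<union> {x<..y}" using that by auto
    moreover have "measure lborel ((U \<inter> {s..x}) \<union> {x<..y}) = m x + measure lborel {x<..y}"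
      unfolding m_def using U(1) fm[of s x] that
      by (intro measure_Union) (auto simp: fmeasurable_def borel_open)
    ultimately show ?thesis using that by (simp add: m_def)
  qed
  \<comment> \<open>The estimate is additive over adjacent intervals, so bisection reduces it to
    short intervals around a point. Such intervals may stick out of [s,t]; the premises make
    \<open>P\<close> vacuous for those. One \<epsilon> pays for the differentiability of
    \<open>F\<close>, the other for that of \<open>B\<close>.\<close>
  define P where "P x y \<longleftrightarrow> s \<le> x \<longrightarrow> y \<le> t \<longrightarrow>
    norm (F y - F x) \<le> B y - B x + 2 * \<epsilon> * (y - x) + L * (m y - m x)" for x y
  have "P s t"
    using \<open>s \<le> t\<close>
  proof (induction rule: Bolzano)
    case (trans x y z)
    have "norm (F z - F x) \<le> norm (F z - F y) + norm (F y - F x)"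
      using norm_triangle_ineq[of "F z - F y" "F y - F x"] by simp
    then show ?case using trans by (auto simp: P_def algebra_simps)
  next
    case (local x)
    then have x: "x \<in> {s..t}" by simp
    have "\<forall>\<^sub>F y in at x within {s..t}. norm (B y - B x - (y - x) * b x) \<le> \<epsilon> * norm (y - x)"
      using has_derivative_within_alt2[of B "\<lambda>h. h * b x" x "{s..t}"] B[OF x] \<epsilon>
      by (simp add: has_field_derivative_def mult_commute_abs)
    \<comment> \<open>One bound covers both kinds of points: the first two terms suffice where the
      derivative is controlled, the last one at points of \<open>N\<close>, near which
      \<open>m\<close> has slope one.\<close>
    moreover have "\<forall>\<^sub>F y in at x within {s..t}. norm (F y - F x) \<le> \<bar>y - x\<bar> * b x + \<epsilon> * \<bar>y - x\<bar> + L * \<bar>m y - m x\<bar>"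
    proof (cases "x \<in> N")
      case True
      then obtain d where d: "d > 0" "ball x d \<subseteq> U"
        using U(1,2) open_contains_ball by blast
      have "\<forall>\<^sub>F y in at x within {s..t}. y \<in> ball x d \<and> y \<in> {s..t}"
        using d by (auto simp: eventually_at dist_commute)
      then show ?thesis
      proof eventually_elim
        case (elim y)
        have "norm (F y - F x) \<le> L * \<bar>y - x\<bar>"
          using lipschitz_onD[OF lip, of y x] elim x by (simp add: dist_norm)
        moreover have "\<bar>m y - m x\<bar> = \<bar>y - x\<bar>"
        proof (cases "x \<le> y")
          case True
          have "{x..y} \<subseteq> ball x d" using elim by (auto simp: dist_real_def)
          then have "m y - m x = y - x" using m_inc[of x y] d True x by auto
          then show ?thesis by linarith
        next
          case False
          have "{y..x} \<subseteq> ball x d" using elim by (auto simp: dist_real_def)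
          then have "m x - m y = x - y" using m_inc[of y x] d False elim by auto
          then show ?thesis by linarith
        qed
        ultimately show ?case using b[OF x] \<epsilon> by (simp add: add_nonneg_nonneg add_increasing)
      qed
    next
      case False
      then obtain d where d: "(F has_vector_derivative d) (at x within {s..t})" "norm d \<le> b x"
        using N(2) x by auto
      have "\<forall>\<^sub>F y in at x within {s..t}. norm (F y - F x - (y - x) *\<^sub>R d) \<le> \<epsilon> * norm (y - x)"
        using has_derivative_within_alt2[of F "\<lambda>h. h *\<^sub>R d" x "{s..t}"] d(1) \<epsilon>
        by (auto simp: has_vector_derivative_def)
      then show ?thesis
      proof eventually_elim
        case (elim y)
        have "norm (F y - F x) \<le> norm (F y - F x - (y - x) *\<^sub>R d) + norm ((y - x) *\<^sub>R d)"
          using norm_triangle_ineq[of "F y - F x - (y - x) *\<^sub>R d" "(y - x) *\<^sub>R d"] by simp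
        also have "norm ((y - x) *\<^sub>R d) \<le> \<bar>y - x\<bar> * b x"
          using d(2) by (simp add: mult_left_mono)
        finally show ?case using elim L0 by (simp add: add_increasing2)
      qed
    qed
    ultimately have "\<forall>\<^sub>F y in at x within {s..t}.
        norm (B y - B x - (y - x) * b x) \<le> \<epsilon> * norm (y - x) \<and>
        norm (F y - F x) \<le> \<bar>y - x\<bar> * b x + \<epsilon> * \<bar>y - x\<bar> + L * \<bar>m y - m x\<bar>"
      by eventually_elim auto
    then obtain d where d: "d > 0" "\<And>y. y \<in> {s..t} \<Longrightarrow> y \<noteq> x \<Longrightarrow> \<bar>y - x\<bar> < d \<Longrightarrow>
        \<bar>B y - B x - (y - x) * b x\<bar> \<le> \<epsilon> * \<bar>y - x\<bar> \<and>
        norm (F y - F x) \<le> \<bar>y - x\<bar> * b x + \<epsilon> * \<bar>y - x\<bar> + L * \<bar>m y - m x\<bar>"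
      unfolding eventually_at by (auto simp: dist_real_def)
    have right: "norm (F y - F x) \<le> B y - B x + 2 * \<epsilon> * (y - x) + L * (m y - m x)"
      if "x \<le> y" "y \<le> t" "y - x < d" for y
    proof (cases "y = x")
      case False
      then show ?thesis
        using d(2)[of y] that x m_mono[OF \<open>x \<le> y\<close>] by (auto simp: abs_le_iff)
    qed auto
    have left: "norm (F x - F y) \<le> B x - B y + 2 * \<epsilon> * (x - y) + L * (m x - m y)"
      if "s \<le> y" "y \<le> x" "x - y < d" for y
    proof (cases "y = x")
      case False
      have "\<bar>B y - B x - (y - x) * b x\<bar> \<le> \<epsilon> * (x - y)"
        "norm (F x - F y) \<le> (x - y) * b x + \<epsilon> * (x - y) + L * (m x - m y)"
        using d(2)[of y] that x m_mono[OF \<open>y \<le> x\<close>] False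
        by (auto simp: norm_minus_commute abs_minus_commute)
      then show ?thesis by (auto simp: abs_le_iff algebra_simps)
    qed auto
    show ?case
    proof (intro exI[of _ d] conjI allI impI d(1))
      fix y z assume yz: "y \<le> x \<and> x \<le> z \<and> z - y < d"
      show "P y z"
        unfolding P_def
      proof (intro impI)
        assume "s \<le> y" "z \<le> t"
        have "norm (F z - F y) \<le> norm (F z - F x) + norm (F x - F y)"
          using norm_triangle_ineq[of "F z - F x" "F x - F y"] by simp
        also have "\<dots> \<le> (B z - B x + 2 * \<epsilon> * (z - x) + L * (m z - m x)) + (B x - B y + 2 * \<epsilon> * (x - y) + L * (m x - m y))"
          using yz \<open>s \<le> y\<close> \<open>z \<le> t\<close> by (intro add_mono left right) auto
        finally show "norm (F z - F y) \<le> B z - B y + 2 * \<epsilon> * (z - y) + L * (m z - m y)"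
          by (simp add: algebra_simps)
      qed
    qed
  qed
  then have "norm (F t - F s) \<le> B t - B s + 2 * \<epsilon> * (t - s) + L * (m t - m s)"
    by (simp add: P_def)
  also have "m t - m s \<le> \<epsilon>" using mU[of t] by (simp add: m_def add_increasing2 diff_le_eq)
  then have "L * (m t - m s) \<le> L * \<epsilon>" using L0 by (rule mult_left_mono)
  also have "B t - B s + 2 * \<epsilon> * (t - s) + L * \<epsilon> \<le> B t - B s + \<epsilon> * (2 * (t - s) + L + 1)"
    using \<epsilon> by (simp add: algebra_simps)
  also have "\<epsilon> * (2 * (t - s) + L + 1) = e"
    using \<open>s \<le> t\<close> L0 by (simp add: \<epsilon>_def)
  finally show "norm (F t - F s) \<le> B t - B s + e" by simp
qed

text \<open>The bound is on the integral rather than on \<open>N\<close>, because the integral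
  dominates the distance from the starting value; this gives exp - 1 in place of exp.\<close>

lemma gronwall_integral:
  fixes N :: "real \<Rightarrow> real"
  assumes "0 \<le> \<tau>" and cont: "continuous_on {0..\<tau>} N" and "c > 0"
    and le: "\<And>t. t \<in> {0..\<tau>} \<Longrightarrow> N t \<le> n0 + integral {0..t} (\<lambda>s. c * N s + \<eta>)"
  shows "integral {0..\<tau>} (\<lambda>s. c * N s + \<eta>) \<le> (n0 + \<eta> / c) * (exp (c * \<tau>) - 1)"
proof -
  define W where "W t = integral {0..t} (\<lambda>s. c * N s + \<eta>)" for t
  \<comment> \<open>Integrating factor for the comparison equation W' = c(W + n0) + \<eta>, whose
    equilibrium is -(n0 + \<eta>/c). The hypothesis on \<open>N\<close> says exactly that V' \<le>
    0.\<close>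
  define V where "V t = exp (- c * t) * (W t + n0 + \<eta> / c)" for t
  have cont': "continuous_on {0..\<tau>} (\<lambda>s. c * N s + \<eta>)"
    by (intro continuous_intros cont)
  have W: "(W has_real_derivative (c * N t + \<eta>)) (at t within {0..\<tau>})" if "t \<in> {0..\<tau>}" for t
    unfolding W_def has_real_derivative_iff_has_vector_derivative
    by (rule integral_has_vector_derivative[OF cont' that])
  have V: "(V has_real_derivative exp (- c * t) * (c * (N t - n0 - W t))) (at t within {0..\<tau>})"
    if "t \<in> {0..\<tau>}" for t
    unfolding V_def using \<open>c > 0\<close>
    by (auto intro!: derivative_eq_intros W[OF that] simp: field_simps)
  have "V \<tau> \<le> V 0"
  proof (rule DERIV_nonpos_imp_decreasing_open[OF \<open>0 \<le> \<tau>\<close>])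
    show "continuous_on {0..\<tau>} V"
      using V by (meson DERIV_continuous continuous_on_eq_continuous_within)
    fix t assume t: "0 < t" "t < \<tau>"
    have "(V has_real_derivative exp (- c * t) * (c * (N t - n0 - W t))) (at t)"
      using V[of t] t at_within_Icc_at[of 0 t \<tau>] by simp
    moreover have "exp (- c * t) * (c * (N t - n0 - W t)) \<le> 0"
      using le[of t] t \<open>c > 0\<close> by (intro mult_nonneg_nonpos) (auto simp: W_def)
    ultimately show "\<exists>y. (V has_real_derivative y) (at t) \<and> y \<le> 0" by blast
  qed
  then have "exp (- (c * \<tau>)) * (W \<tau> + n0 + \<eta> / c) \<le> n0 + \<eta> / c"
    by (simp add: V_def W_def)
  then have "W \<tau> + n0 + \<eta> / c \<le> exp (c * \<tau>) * (n0 + \<eta> / c)"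
    by (simp add: exp_minus field_simps)
  then show ?thesis by (simp add: W_def algebra_simps)
qed

subsection \<open>Translates of a curve\<close>

lemma AE_AE_translate_curve:
  fixes \<gamma> :: "real \<Rightarrow> 'a::euclidean_space"
  assumes cont: "continuous_on {0..T} \<gamma>" and ae: "AE y in lebesgue. P y"
  shows "AE h in lborel. AE t in lborel. t \<in> {0..T} \<longrightarrow> P (\<gamma> t + h)"
proof -
  \<comment> \<open>A Borel null set is wanted, so that its preimage under (t,h) \<mapsto>
    \<gamma>(t) + h is measurable in the product. For the same reason \<gamma> is extended by 0 to a
    Borel function on the whole line.\<close>
  have "AE y in lborel. P y"
    using ae by (rule AE_completion_iff[THEN iffD1])
  then obtain N where N: "N \<in> null_sets lborel" "{y \<in> space lborel. \<not> P y} \<subseteq> N"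
    unfolding eventually_ae_filter by blast
  have Nb: "N \<in> sets borel" using N(1) by auto
  define R where "R t h \<longleftrightarrow> t \<in> {0..T} \<longrightarrow> \<gamma> t + h \<notin> N" for t :: real and h
  define \<gamma>' where "\<gamma>' t = (if t \<in> {0..T} then \<gamma> t else 0)" for t
  have \<gamma>': "\<gamma>' \<in> borel_measurable borel"
    unfolding \<gamma>'_def using borel_measurable_continuous_on_if[OF _ cont, of "\<lambda>_. 0"] by simp
  have "{x \<in> space (lborel \<Otimes>\<^sub>M lborel). R (fst x) (snd x)}
      = {x \<in> space (lborel \<Otimes>\<^sub>M lborel). fst x \<in> {0..T} \<longrightarrow> \<gamma>' (fst x) + snd x \<notin> N}"
    by (auto simp: R_def \<gamma>'_def)
  also have "\<dots> \<in> sets (lborel \<Otimes>\<^sub>M lborel)"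
    using \<gamma>' Nb by measurable
  finally have meas: "{x \<in> space (lborel \<Otimes>\<^sub>M lborel). R (fst x) (snd x)}
      \<in> sets (lborel \<Otimes>\<^sub>M (lborel :: 'a measure))" .
  \<comment> \<open>For fixed t the bad h form a translate of \<open>N\<close>, which is null;
    Fubini then swaps the quantifiers.\<close>
  have "AE h in lborel. R t h" for t
  proof (rule AE_I'[OF null_sets_translation[OF N(1), of "- \<gamma> t"]])
    show "{h \<in> space lborel. \<not> R t h} \<subseteq> {h. h - (- \<gamma> t) \<in> N}"
      by (auto simp: R_def add.commute)
  qed
  then have "AE t in lborel. AE h in lborel. R t h" by simp
  then have "AE h in lborel. AE t in lborel. R t h"
    using lborel_pair.AE_commute[OF meas] by simp
  then show ?thesis
    using N(2) by (auto simp: R_def elim!: eventually_mono)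
qed

lemma AE_lborel_obtain_small:
  fixes P :: "'a::euclidean_space \<Rightarrow> bool"
  assumes "AE h in lborel. P h" "e > 0"
  obtains h where "norm h < e" "P h"
proof (rule ccontr)
  assume "\<not> thesis"
  then have sub: "ball 0 e \<subseteq> {h. \<not> P h}" using that by auto
  obtain N where "N \<in> null_sets lborel" "{y \<in> space lborel. \<not> P y} \<subseteq> N"
    using assms(1) unfolding eventually_ae_filter by blast
  then have "N \<in> null_sets lebesgue" "ball 0 e \<subseteq> N"
    using sub by (auto intro: null_sets_completionI)
  then have "negligible (ball (0::'a) e)"
    using negligible_iff_null_sets negligible_subset by blast
  then show False using open_not_negligible[of "ball (0::'a) e"] assms(2) by auto
qed

subsection \<open>Minors along subunit paths\<close>

lemma Lambda_norm_eq_L2_set: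
  "Lambda_norm q g p x = L2_set (\<lambda>(J, K). YIK g J K x) (multi_idx p q \<times> coord_idx p)"
  unfolding Lambda_norm_def L2_set_def sum.cartesian_product by (simp add: case_prod_unfold)

lemma Lambda_dist_eq_L2_set:
  "Lambda_dist q g p y x = L2_set (\<lambda>(J, K). YIK g J K y - YIK g J K x) (multi_idx p q \<times> coord_idx p)"
  unfolding Lambda_dist_def L2_set_def sum.cartesian_product by (simp add: case_prod_unfold)

lemma Lambda_norm_le_add_dist:
  "Lambda_norm q g p y \<le> Lambda_norm q g p x + Lambda_dist q g p y x"
  using L2_set_triangle_ineq[of "\<lambda>(J, K). YIK g J K x" "\<lambda>(J, K). YIK g J K y - YIK g J K x"
      "multi_idx p q \<times> coord_idx p"]
  by (simp add: Lambda_norm_eq_L2_set Lambda_dist_eq_L2_set case_prod_unfold)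

lemma YI_dist_le_Lambda_dist:
  assumes "I \<in> multi_idx p q"
  shows "YI_dist g p I y x \<le> Lambda_dist q g p y x"
  unfolding YI_dist_def Lambda_dist_def real_sqrt_le_iff
  using assms
  by (intro member_le_sum[where f="\<lambda>J. \<Sum>K\<in>coord_idx p. (YIK g J K y - YIK g J K x)\<^sup>2"])
    (auto intro: sum_nonneg finite_multi_idx)

lemma continuous_on_det_nat:
  assumes "\<And>a b. a < p \<Longrightarrow> b < p \<Longrightarrow> continuous_on S (M a b)"
  shows "continuous_on S (\<lambda>x. det_nat p (\<lambda>a b. M a b x))"
  unfolding det_nat_def
proof (intro continuous_intros)
  fix \<sigma> :: "nat \<Rightarrow> nat" and a assume "\<sigma> \<in> {\<sigma>. \<sigma> permutes {..<p}}" "a \<in> {..<p}"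
  then show "continuous_on S (M a (\<sigma> a))"
    using permutes_in_image[of \<sigma> "{..<p}" a] assms by simp
qed

lemma continuous_on_YIK:
  assumes "J \<in> multi_idx p q" "\<And>j. j < q \<Longrightarrow> continuous_on S (g j)"
  shows "continuous_on S (YIK g J K)"
  unfolding YIK_eq_det_nat[OF assms(1)]
  by (intro continuous_on_det_nat bounded_linear.continuous_on[OF bounded_linear_vec_nth] assms(2) sorted_list_multi_idx_less[OF assms(1)])

lemma continuous_on_Lambda_norm:
  assumes "\<And>j. j < q \<Longrightarrow> continuous_on S (g j)"
  shows "continuous_on S (Lambda_norm q g p)"
  unfolding Lambda_norm_def by (intro continuous_intros continuous_on_YIK[OF _ assms])

section \<open>Confinement of subunit paths and growth of the minors along them\<close>

lemma norm_subunit_combination_le: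
  fixes v :: "nat \<Rightarrow> 'a::real_normed_vector"
  assumes "coef_norm q c \<le> 1" "\<And>j. j < q \<Longrightarrow> norm (v j) \<le> M"
  shows "norm (\<Sum>j<q. c j *\<^sub>R v j) \<le> q * M"
proof -
  have "norm (c j *\<^sub>R v j) \<le> M" if "j < q" for j
  proof -
    have "\<bar>c j\<bar> \<le> 1" using abs_le_coef_norm[OF that, of c] assms(1) by simp
    then have "\<bar>c j\<bar> * norm (v j) \<le> 1 * M"
      using assms(2)[OF that] by (intro mult_mono) auto
    then show ?thesis by simp
  qed
  then have "norm (\<Sum>j<q. c j *\<^sub>R v j) \<le> (\<Sum>j<q. M)"
    by (intro order.trans[OF norm_sum] sum_mono) auto
  then show ?thesis by simp
qed

text \<open>A first exit argument: as long as the path is within distance 1 of its start its speed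
  is at most q M, so it cannot have reached distance 1 before time 1/(q M).\<close>

lemma subunit_path_in_unit_ball:
  fixes g :: "nat \<Rightarrow> real^'n \<Rightarrow> real^'n"
  assumes path: "subunit_path q g T \<gamma>"
    and gM: "\<And>j y. j < q \<Longrightarrow> y \<in> cball (\<gamma> 0) 1 \<Longrightarrow> norm (g j y) \<le> M"
    and "0 \<le> M" "t \<in> {0..T}" "q * M * t < 1"
  shows "norm (\<gamma> t - \<gamma> 0) < 1"
proof (rule ccontr)
  assume "\<not> norm (\<gamma> t - \<gamma> 0) < 1"
  obtain L u where L: "L-lipschitz_on {0..T} \<gamma>"
    and u: "AE t in lborel. t \<in> {0..T} \<longrightarrow>
        (\<gamma> has_vector_derivative (\<Sum>j<q. u t j *\<^sub>R g j (\<gamma> t))) (at t within {0..T}) \<and>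
        coef_norm q (u t) \<le> 1"
    using path unfolding subunit_path_def by blast
  have cont: "continuous_on {0..t} \<gamma>"
    using lipschitz_on_continuous_on[OF L] by (rule continuous_on_subset) (use assms(4) in auto)
  define Z where "Z = {0..t} \<inter> (\<lambda>s. norm (\<gamma> s - \<gamma> 0)) -` {1..}"
  have "closed Z"
    unfolding Z_def by (intro continuous_closed_preimage continuous_intros cont)
  then have "compact Z"
    unfolding compact_eq_bounded_closed by (auto simp: Z_def intro: bounded_subset[OF bounded_closed_interval])
  moreover have "t \<in> Z"
    using \<open>\<not> norm (\<gamma> t - \<gamma> 0) < 1\<close> assms(4) by (auto simp: Z_def)
  ultimately obtain s where s: "s \<in> Z" "\<And>r. r \<in> Z \<Longrightarrow> s \<le> r"
    using compact_attains_inf[of Z] by blast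
  have st: "0 \<le> s" "s \<le> t" "1 \<le> norm (\<gamma> s - \<gamma> 0)" using s(1) by (auto simp: Z_def)
  have before: "norm (\<gamma> r - \<gamma> 0) < 1" if "0 \<le> r" "r < s" for r
    using s(2)[of r] that st by (force simp: Z_def)
  have "norm (\<gamma> s - \<gamma> 0) \<le> q * M * s - q * M * 0"
  proof (rule lipschitz_mean_value_inequality_ae[OF st(1), where b="\<lambda>_. q * M"])
    show "L-lipschitz_on {0..s} \<gamma>"
      using L by (rule lipschitz_on_subset) (use st assms(4) in auto)
    show "AE r in lborel. r \<in> {0..s} \<longrightarrow>
        (\<exists>d. (\<gamma> has_vector_derivative d) (at r within {0..s}) \<and> norm d \<le> q * M)"
      \<comment> \<open>The exit time s itself is discarded as a null set, since only earlier points
        are known to lie in the ball.\<close>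
      using u AE_lborel_singleton[of s]
    proof eventually_elim
      case (elim r)
      show ?case
      proof
        assume r: "r \<in> {0..s}"
        then have "r \<in> {0..T}" using st assms(4) by auto
        with elim have d: "(\<gamma> has_vector_derivative (\<Sum>j<q. u r j *\<^sub>R g j (\<gamma> r))) (at r within {0..T})"
          "coef_norm q (u r) \<le> 1" by auto
        have "\<gamma> r \<in> cball (\<gamma> 0) 1"
          using before[of r] r elim by (auto simp: dist_norm norm_minus_commute)
        then have "norm (\<Sum>j<q. u r j *\<^sub>R g j (\<gamma> r)) \<le> q * M"
          using d(2) gM by (intro norm_subunit_combination_le) auto
        moreover have "(\<gamma> has_vector_derivative (\<Sum>j<q. u r j *\<^sub>R g j (\<gamma> r))) (at r within {0..s})"
          using d(1) by (rule has_vector_derivative_within_subset) (use st assms(4) in auto)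
        ultimately show "\<exists>d. (\<gamma> has_vector_derivative d) (at r within {0..s}) \<and> norm d \<le> q * M"
          by blast
      qed
    qed
  qed (use \<open>0 \<le> M\<close> in \<open>auto intro!: derivative_eq_intros\<close>)
  also have "\<dots> \<le> q * M * t" using st \<open>0 \<le> M\<close> by (simp add: mult_left_mono)
  finally show False using st(3) assms(5) by simp
qed

text \<open>The translated path moves with the velocity of the fields at \<gamma>(s), while the
  derivative estimate at \<gamma>(s) + h concerns the fields there. The constant \<open>A\<close>
  controls the fields at the translated point, \<open>E\<close> the difference; the factor q comes
  from summing the q controls, each at most 1 in absolute value.\<close>

lemma YIK_translated_path_bound:
  fixes g :: "nat \<Rightarrow> real^('n::{finite,linorder}) \<Rightarrow> real^('n::{finite,linorder})"
    and p q :: nat and L B C A E :: real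
  defines "A \<equiv> real p * real CARD('n) * L + real p * real q * C"
    and "E \<equiv> fact p * real p * B ^ (p - 1) * L"
  assumes J: "J \<in> multi_idx p q" and K: "K \<in> coord_idx p"
    and S: "open S" and lip: "\<And>j. j < q \<Longrightarrow> L-lipschitz_on S (g j)"
    and gB: "\<And>j y. j < q \<Longrightarrow> y \<in> S \<Longrightarrow> norm (g j y) \<le> B"
    and nonneg: "0 \<le> L" "0 \<le> B" "0 \<le> C"
    and path: "subunit_path q g T \<gamma>" and t: "t \<in> {0..T}"
    and inS: "\<And>s. s \<in> {0..t} \<Longrightarrow> \<gamma> s \<in> S" "\<And>s. s \<in> {0..t} \<Longrightarrow> \<gamma> s + h \<in> S"
    and good: "AE s in lborel. s \<in> {0..T} \<longrightarrow> \<gamma> s + h \<in> S \<longrightarrow>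
        (\<forall>k<q. g k differentiable (at (\<gamma> s + h))) \<and>
        (\<forall>j<q. \<forall>k<q. \<exists>c. coef_norm q c \<le> C \<and>
            frechet_derivative (g k) (at (\<gamma> s + h)) (g j (\<gamma> s + h))
              - frechet_derivative (g j) (at (\<gamma> s + h)) (g k (\<gamma> s + h))
              = (\<Sum>i<q. c i *\<^sub>R g i (\<gamma> s + h)))"
  shows "\<bar>YIK g J K (\<gamma> t + h) - YIK g J K (\<gamma> 0 + h)\<bar>
    \<le> integral {0..t} (\<lambda>s. q * (A * Lambda_norm q g p (\<gamma> s + h) + E * (L * norm h)))"
proof -
  obtain L' u where L': "L'-lipschitz_on {0..T} \<gamma>"
    and u: "AE t in lborel. t \<in> {0..T} \<longrightarrow>
        (\<gamma> has_vector_derivative (\<Sum>j<q. u t j *\<^sub>R g j (\<gamma> t))) (at t within {0..T}) \<and>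
        coef_norm q (u t) \<le> 1"
    using path unfolding subunit_path_def by blast
  define G where "G s = \<gamma> s + h" for s
  define b where "b s = q * (A * Lambda_norm q g p (G s) + E * (L * norm h))" for s
  have AE0: "0 \<le> A" "0 \<le> E" using nonneg by (auto simp: A_def E_def)
  have G: "(L' + 0)-lipschitz_on {0..t} G"
    unfolding G_def
    by (intro lipschitz_on_add lipschitz_on_constant lipschitz_on_subset[OF L']) (use t in auto)
  have GS: "G ` {0..t} \<subseteq> S" using inS(2) by (auto simp: G_def)
  have contb: "continuous_on {0..t} b"
    unfolding b_def
    by (intro continuous_intros continuous_on_compose2[OF continuous_on_Lambda_norm _ GS]
        lipschitz_on_continuous_on[OF G] lipschitz_on_continuous_on[OF lip])
  \<comment> \<open>Some Lipschitz constant is needed to integrate a derivative bound that holds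
    only almost everywhere; its value does not enter the result.\<close>
  have "\<exists>L. L-lipschitz_on {0..t} (\<lambda>s. YIK g J K (G s))"
    unfolding YIK_eq_det_nat[OF J]
  proof (rule lipschitz_on_det_nat)
    fix a b' assume "b' < p"
    let ?j = "sorted_list_of_set J ! b'" and ?i = "sorted_list_of_set K ! a"
    have "(L * (L' + 0))-lipschitz_on {0..t} (\<lambda>s. g ?j (G s))"
      using lipschitz_on_subset[OF lip GS] G sorted_list_multi_idx_less[OF J \<open>b' < p\<close>]
      by (intro lipschitz_on_compose2)
    then have "(L * (L' + 0))-lipschitz_on {0..t} (\<lambda>s. g ?j (G s) $ ?i)"
      unfolding lipschitz_on_def using dist_vec_nth_le order.trans by blast
    then show "\<exists>L. L-lipschitz_on {0..t} (\<lambda>s. g ?j (G s) $ ?i)" by blast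
  qed simp
  then obtain L'' where L'': "L''-lipschitz_on {0..t} (\<lambda>s. YIK g J K (G s))" by blast
  have "norm (YIK g J K (G t) - YIK g J K (G 0)) \<le> integral {0..t} b - integral {0..0} b"
  proof (rule lipschitz_mean_value_inequality_ae[OF _ L'', where b=b])
    show "0 \<le> t" using t by simp
    show "((\<lambda>s. integral {0..s} b) has_real_derivative b s) (at s within {0..t})" if "s \<in> {0..t}" for s
      unfolding has_real_derivative_iff_has_vector_derivative
      by (rule integral_has_vector_derivative[OF contb that])
    show "0 \<le> b s" for s
      using AE0 nonneg by (auto simp: b_def Lambda_norm_nonneg intro!: mult_nonneg_nonneg add_nonneg_nonneg)
    show "AE s in lborel. s \<in> {0..t} \<longrightarrow> (\<exists>d. ((\<lambda>s. YIK g J K (G s)) has_vector_derivative d)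
        (at s within {0..t}) \<and> norm d \<le> b s)"
      using u good
    proof eventually_elim
      case (elim s)
      show ?case
      proof
        assume s: "s \<in> {0..t}"
        then have sT: "s \<in> {0..T}" using t by auto
        let ?v = "\<Sum>j<q. u s j *\<^sub>R g j (\<gamma> s)"
        have \<gamma>': "(\<gamma> has_vector_derivative ?v) (at s within {0..t})" and us: "coef_norm q (u s) \<le> 1"
          using elim(1) sT t by (auto intro: has_vector_derivative_within_subset)
        have y: "G s \<in> S" using inS(2)[OF s] by (simp add: G_def)
        define D where "D j = frechet_derivative (g j) (at (G s))" for j
        have D: "(g j has_derivative D j) (at (G s))" if "j < q" for j
          using elim(2) sT y that unfolding D_def G_def frechet_derivative_works by blast
        have bracket: "\<exists>c. coef_norm q c \<le> C \<and> D k (g j (G s)) - D j (g k (G s))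
            = (\<Sum>i<q. c i *\<^sub>R g i (G s))" if "j < q" "k < q" for j k
          using elim(2) sT y that unfolding D_def G_def by blast
        obtain Df where Df: "(YIK g J K has_derivative Df) (at (G s))"
          "\<And>w. \<bar>Df w\<bar> \<le> fact p * real p * B ^ (p - 1) * (L * norm w)"
          "\<And>k. k < q \<Longrightarrow> \<bar>Df (g k (G s))\<bar> \<le> A * Lambda_norm q g p (G s)"
          using YIK_has_bounded_derivative[OF J K D norm_has_derivative_le_lipschitz[OF D S y lip]
            gB[OF _ y] bracket] unfolding A_def by blast
        have lin: "linear Df" using Df(1) by (rule has_derivative_linear)
        have "(G has_derivative (\<lambda>r. r *\<^sub>R ?v)) (at s within {0..t})"
          unfolding G_def using \<gamma>'
          by (auto simp: has_vector_derivative_def intro!: derivative_eq_intros)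
        from has_derivative_compose[OF this Df(1)]
        have "((\<lambda>s. YIK g J K (G s)) has_vector_derivative Df ?v) (at s within {0..t})"
          by (simp add: has_vector_derivative_def linear_scale[OF lin])
        moreover have "norm (Df ?v) \<le> b s"
        proof -
          \<comment> \<open>Split g_j(\<gamma>(s)) into g_j(\<gamma>(s) + h), estimated by
            |\<Lambda>_p|, and a remainder of norm at most L|h|, estimated crudely.\<close>
          have "norm (Df (g j (\<gamma> s))) \<le> A * Lambda_norm q g p (G s) + E * (L * norm h)" if "j < q" for j
          proof -
            have "norm (g j (\<gamma> s) - g j (G s)) \<le> L * norm h"
              using lipschitz_onD[OF lip[OF that] inS(1)[OF s] y] by (simp add: G_def dist_norm)
            then have "E * norm (g j (\<gamma> s) - g j (G s)) \<le> E * (L * norm h)"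
              using AE0 by (intro mult_left_mono)
            moreover have "\<bar>Df (g j (\<gamma> s) - g j (G s))\<bar> \<le> E * norm (g j (\<gamma> s) - g j (G s))"
              using Df(2)[of "g j (\<gamma> s) - g j (G s)"] by (simp add: E_def mult.assoc)
            moreover have "Df (g j (\<gamma> s)) = Df (g j (G s)) + Df (g j (\<gamma> s) - g j (G s))"
              by (simp add: linear_diff[OF lin])
            ultimately show ?thesis using Df(3)[OF that] by (simp add: abs_le_iff)
          qed
          then have "norm (\<Sum>j<q. u s j *\<^sub>R Df (g j (\<gamma> s))) \<le> b s"
            unfolding b_def by (intro norm_subunit_combination_le us)
          then show ?thesis
            by (simp add: linear_sum[OF lin] linear_scale[OF lin])
        qed
        ultimately show "\<exists>d. ((\<lambda>s. YIK g J K (G s)) has_vector_derivative d)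
            (at s within {0..t}) \<and> norm d \<le> b s" by blast
      qed
    qed
  qed
  then show ?thesis by (simp add: b_def[abs_def] G_def)
qed

text \<open>The bounds for single entries all have |\<Lambda>_p| on the right. Adding them over the
  m entries, with the Euclidean norm below the sum of absolute values, closes the inequality and
  makes Gronwall applicable.\<close>

lemma Lambda_translated_path_bound:
  fixes g :: "nat \<Rightarrow> real^('n::{finite,linorder}) \<Rightarrow> real^('n::{finite,linorder})"
    and p q :: nat and L B C A E m :: real
  defines "A \<equiv> real p * real CARD('n) * L + real p * real q * C"
    and "E \<equiv> fact p * real p * B ^ (p - 1) * L"
    and "m \<equiv> real (card (multi_idx p q \<times> (coord_idx p :: 'n set set)))"
  assumes S: "open S" and lip: "\<And>j. j < q \<Longrightarrow> L-lipschitz_on S (g j)"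
    and gB: "\<And>j y. j < q \<Longrightarrow> y \<in> S \<Longrightarrow> norm (g j y) \<le> B"
    and nonneg: "0 \<le> L" "0 \<le> B" "0 \<le> C"
    and path: "subunit_path q g T \<gamma>" and t: "t \<in> {0..T}"
    and inS: "\<And>s. s \<in> {0..t} \<Longrightarrow> \<gamma> s \<in> S" "\<And>s. s \<in> {0..t} \<Longrightarrow> \<gamma> s + h \<in> S"
    and good: "AE s in lborel. s \<in> {0..T} \<longrightarrow> \<gamma> s + h \<in> S \<longrightarrow>
        (\<forall>k<q. g k differentiable (at (\<gamma> s + h))) \<and>
        (\<forall>j<q. \<forall>k<q. \<exists>c. coef_norm q c \<le> C \<and>
            frechet_derivative (g k) (at (\<gamma> s + h)) (g j (\<gamma> s + h))
              - frechet_derivative (g j) (at (\<gamma> s + h)) (g k (\<gamma> s + h))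
              = (\<Sum>i<q. c i *\<^sub>R g i (\<gamma> s + h)))"
  shows "Lambda_dist q g p (\<gamma> t + h) (\<gamma> 0 + h) \<le>
    (Lambda_norm q g p (\<gamma> 0 + h) + m * (q * (E * (L * norm h)))) * (exp ((m * q * A + 1) * t) - 1)"
proof -
  define N where "N s = Lambda_norm q g p (\<gamma> s + h)" for s
  define \<eta> where "\<eta> = m * (q * (E * (L * norm h)))"
  \<comment> \<open>The summand 1 makes c \<ge> 1, so that Gronwall may divide by c and \<eta>/c may
    be replaced by \<eta>.\<close>
  define c where "c = m * q * A + 1"
  have A0: "0 \<le> A" and E0: "0 \<le> E" and m0: "0 \<le> m"
    using nonneg by (auto simp: A_def E_def m_def)
  have c1: "1 \<le> c" using A0 m0 by (simp add: c_def)
  have \<eta>0: "0 \<le> \<eta>" using E0 m0 nonneg by (simp add: \<eta>_def)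
  have contN: "continuous_on {0..t} N"
  proof -
    obtain L' where L': "L'-lipschitz_on {0..T} \<gamma>" using path unfolding subunit_path_def by blast
    have "continuous_on {0..t} \<gamma>"
      by (rule continuous_on_subset[OF lipschitz_on_continuous_on[OF L']]) (use t in auto)
    then show ?thesis
      unfolding N_def using inS(2)
      by (intro continuous_on_compose2[OF continuous_on_Lambda_norm, of q S g] continuous_intros
          lipschitz_on_continuous_on[OF lip]) auto
  qed
  have dist: "Lambda_dist q g p (\<gamma> s + h) (\<gamma> 0 + h) \<le> integral {0..s} (\<lambda>r. c * N r + \<eta>)"
    if s: "s \<in> {0..t}" for s
  proof -
    have cont: "continuous_on {0..s} N" using contN by (rule continuous_on_subset) (use s in auto)
    define I where "I = integral {0..s} (\<lambda>r. q * (A * N r + E * (L * norm h)))"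
    have comp: "\<bar>YIK g J K (\<gamma> s + h) - YIK g J K (\<gamma> 0 + h)\<bar> \<le> I"
      if "J \<in> multi_idx p q" "K \<in> coord_idx p" for J K
      unfolding I_def N_def A_def E_def
      using s t inS by (intro YIK_translated_path_bound[OF that S lip gB nonneg path _ _ _ good]) auto
    have "Lambda_dist q g p (\<gamma> s + h) (\<gamma> 0 + h) \<le> (\<Sum>x\<in>multi_idx p q \<times> (coord_idx p :: 'n set set).
        \<bar>case x of (J, K) \<Rightarrow> YIK g J K (\<gamma> s + h) - YIK g J K (\<gamma> 0 + h)\<bar>)"
      unfolding Lambda_dist_eq_L2_set by (rule L2_set_le_sum_abs)
    also have "\<dots> \<le> (\<Sum>x\<in>multi_idx p q \<times> (coord_idx p :: 'n set set). I)"
      using comp by (intro sum_mono) auto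
    also have "\<dots> = m * I" by (simp add: m_def)
    also have "\<dots> = integral {0..s} (\<lambda>r. m * (q * (A * N r + E * (L * norm h))))"
      unfolding I_def by simp
    also have "\<dots> \<le> integral {0..s} (\<lambda>r. c * N r + \<eta>)"
    proof (rule integral_le)
      show "m * (q * (A * N r + E * (L * norm h))) \<le> c * N r + \<eta>" for r
        using Lambda_norm_nonneg[of q g p "\<gamma> r + h"] by (simp add: c_def \<eta>_def N_def algebra_simps)
    qed (intro integrable_continuous_interval continuous_intros cont)+
    finally show ?thesis .
  qed
  have "integral {0..t} (\<lambda>r. c * N r + \<eta>) \<le> (N 0 + \<eta> / c) * (exp (c * t) - 1)"
  proof (rule gronwall_integral[OF _ contN])
    fix s assume "s \<in> {0..t}"
    from dist[OF this] show "N s \<le> N 0 + integral {0..s} (\<lambda>r. c * N r + \<eta>)"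
      unfolding N_def using Lambda_norm_le_add_dist[of q g p "\<gamma> s + h" "\<gamma> 0 + h"] by simp
  qed (use t c1 in auto)
  also have "\<dots> \<le> (N 0 + \<eta>) * (exp (c * t) - 1)"
  proof (rule mult_right_mono)
    have "\<eta> / c \<le> \<eta> / 1" using c1 \<eta>0 by (intro divide_left_mono) auto
    then show "N 0 + \<eta> / c \<le> N 0 + \<eta>" by simp
  qed (use c1 t in simp)
  finally show ?thesis
    using dist[of t] t by (simp add: N_def \<eta>_def c_def)
qed

lemma Lambda_path_bound:
  fixes g :: "nat \<Rightarrow> real^('n::{finite,linorder}) \<Rightarrow> real^('n::{finite,linorder})"
    and p q :: nat and L B C A m :: real
  defines "A \<equiv> real p * real CARD('n) * L + real p * real q * C"
    and "m \<equiv> real (card (multi_idx p q \<times> (coord_idx p :: 'n set set)))"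
  assumes cont: "\<And>j. j < q \<Longrightarrow> continuous_on UNIV (g j)"
    and S: "open S" and lip: "\<And>j. j < q \<Longrightarrow> L-lipschitz_on S (g j)"
    and gB: "\<And>j y. j < q \<Longrightarrow> y \<in> S \<Longrightarrow> norm (g j y) \<le> B"
    and nonneg: "0 \<le> L" "0 \<le> B" "0 \<le> C"
    and path: "subunit_path q g T \<gamma>" and t: "t \<in> {0..T}"
    and inS: "\<And>s. s \<in> {0..t} \<Longrightarrow> ball (\<gamma> s) 1 \<subseteq> S"
    and good: "AE y in lebesgue. y \<in> S \<longrightarrow>
        (\<forall>k<q. g k differentiable (at y)) \<and>
        (\<forall>j<q. \<forall>k<q. \<exists>c. coef_norm q c \<le> C \<and>
            frechet_derivative (g k) (at y) (g j y) - frechet_derivative (g j) (at y) (g k y)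
              = (\<Sum>i<q. c i *\<^sub>R g i y))"
  shows "Lambda_dist q g p (\<gamma> t) (\<gamma> 0) \<le>
    Lambda_norm q g p (\<gamma> 0) * (exp ((m * q * A + 1) * t) - 1)"
proof (rule ccontr)
  assume neg: "\<not> ?thesis"
  define E where "E = fact p * real p * B ^ (p - 1) * L"
  \<comment> \<open>The slack in the translated estimate. At h = 0 the error term vanishes and F(0)
    < 0 is the negated claim; by continuity F is then negative near 0, against the translated
    estimate for arbitrarily small good h.\<close>
  define F where "F h = (Lambda_norm q g p (\<gamma> 0 + h) + m * (q * (E * (L * norm h))))
      * (exp ((m * q * A + 1) * t) - 1) - Lambda_dist q g p (\<gamma> t + h) (\<gamma> 0 + h)" for h
  have shift: "continuous_on UNIV (\<lambda>h. f (y + h))" if "continuous_on UNIV f"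
    for f :: "real^('n::{finite,linorder}) \<Rightarrow> real" and y
    by (rule continuous_on_compose2[OF that]) (auto intro!: continuous_intros)
  have "continuous_on UNIV F"
    unfolding F_def Lambda_dist_def
    by (intro continuous_intros shift continuous_on_YIK[of _ p q] continuous_on_Lambda_norm cont)
  then have "isCont F 0" by (simp add: continuous_on_eq_continuous_at)
  moreover have "F 0 < 0" using neg by (simp add: F_def)
  ultimately have "\<forall>\<^sub>F h in at 0. F h < 0"
    by (intro order_tendstoD) (auto simp: isCont_def)
  then obtain d where d: "d > 0" "\<And>h. h \<noteq> 0 \<Longrightarrow> norm h < d \<Longrightarrow> F h < 0"
    unfolding eventually_at by auto
  obtain L' where "L'-lipschitz_on {0..T} \<gamma>" using path unfolding subunit_path_def by blast
  from AE_AE_translate_curve[OF lipschitz_on_continuous_on[OF this] good]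
  obtain h where h: "norm h < min d 1" and
    ae: "AE s in lborel. s \<in> {0..T} \<longrightarrow> \<gamma> s + h \<in> S \<longrightarrow>
        (\<forall>k<q. g k differentiable (at (\<gamma> s + h))) \<and>
        (\<forall>j<q. \<forall>k<q. \<exists>c. coef_norm q c \<le> C \<and>
            frechet_derivative (g k) (at (\<gamma> s + h)) (g j (\<gamma> s + h))
              - frechet_derivative (g j) (at (\<gamma> s + h)) (g k (\<gamma> s + h))
              = (\<Sum>i<q. c i *\<^sub>R g i (\<gamma> s + h)))"
    by (rule AE_lborel_obtain_small[where e="min d 1"]) (use d(1) in auto)
  have "\<gamma> s \<in> S" "\<gamma> s + h \<in> S" if "s \<in> {0..t}" for s
    using inS[OF that] h by (auto simp: subset_iff dist_norm)
  then have "0 \<le> F h"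
    unfolding F_def A_def E_def m_def
    using Lambda_translated_path_bound[OF S lip gB nonneg path t _ _ ae, where p=p] by simp
  then show False
    using d(2)[of h] h \<open>F 0 < 0\<close> by (cases "h = 0") auto
qed

section \<open>Choice of constants and the uniform estimate\<close>

theorem theorem2p3:
  fixes q :: nat and g :: "nat \<Rightarrow> real^('n::{finite,linorder}) \<Rightarrow> real^('n::{finite,linorder})"
    and \<Omega> :: "(real^('n::{finite,linorder})) set"
  assumes lip: "\<forall>j<q. locally_lipschitz (g j)"
    and H: "condH q g"
    and bdd: "bounded \<Omega>"
  shows "\<exists>C>0. \<forall>x\<in>\<Omega>. \<forall>T \<gamma>. subunit_path q g T \<gamma> \<and> \<gamma> 0 = x \<longrightarrow>
           (\<forall>p\<in>{1..min q CARD('n::{finite,linorder})}. \<forall>t\<in>{0..min T (1/C)}.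
              Lambda_dist q g p (\<gamma> t) x \<le> Lambda_norm q g p x * (exp (C*t) - 1) \<and>
              (\<forall>I\<in>multi_idx p q.
                 YI_dist g p I (\<gamma> t) x \<le> C * Lambda_norm q g p x * (exp (C*t) - 1)))"
proof -
  obtain R where R: "\<And>x. x \<in> \<Omega> \<Longrightarrow> norm x \<le> R" using bdd unfolding bounded_iff by blast
  \<comment> \<open>The radius leaves room for a start of norm at most R, one unit for the path and
    one for the translation, with slack.\<close>
  define S :: "(real^('n::{finite,linorder})) set" where "S = ball 0 (R + 3)"
  have loc: "locally_lipschitz (g j)" if "j < q" for j using lip that by simp
  obtain L B where LB: "0 \<le> L" "0 \<le> B"
    and L': "\<And>j. j < q \<Longrightarrow> L-lipschitz_on (cball 0 (R + 3)) (g j)"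
    and B': "\<And>j y. j < q \<Longrightarrow> y \<in> cball 0 (R + 3) \<Longrightarrow> norm (g j y) \<le> B"
    by (rule finite_family_locally_lipschitz_on_compact[OF loc compact_cball[of 0 "R + 3"]]) blast+
  have L: "L-lipschitz_on S (g j)" if "j < q" for j
    using L'[OF that] by (rule lipschitz_on_subset) (auto simp: S_def)
  have B: "norm (g j y) \<le> B" if "j < q" "y \<in> S" for j y
    using B'[OF that(1), of y] that(2) by (simp add: S_def)
  have cont: "continuous_on UNIV (g j)" if "j < q" for j
    using loc[OF that] by (rule locally_lipschitz_imp_continuous_on)
  obtain C0 where C0: "AE y in lebesgue. y \<in> S \<longrightarrow>
        (\<forall>k<q. g k differentiable (at y)) \<and>
        (\<forall>j<q. \<forall>k<q. \<exists>c. coef_norm q c \<le> C0 \<and>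
            frechet_derivative (g k) (at y) (g j y) - frechet_derivative (g j) (at y) (g k y)
              = (\<Sum>i<q. c i *\<^sub>R g i y))"
    using H unfolding condH_def S_def by (meson bounded_ball open_ball)
  \<comment> \<open>The constant from (H) comes without a sign; the maximum makes it
    nonnegative.\<close>
  define C1 where "C1 = max C0 0"
  have C1: "AE y in lebesgue. y \<in> S \<longrightarrow>
        (\<forall>k<q. g k differentiable (at y)) \<and>
        (\<forall>j<q. \<forall>k<q. \<exists>c. coef_norm q c \<le> C1 \<and>
            frechet_derivative (g k) (at y) (g j y) - frechet_derivative (g j) (at y) (g k y)
              = (\<Sum>i<q. c i *\<^sub>R g i y))"
    using C0
  proof eventually_elim
    case (elim y)
    have "C0 \<le> C1" by (simp add: C1_def)
    with elim show ?case by (meson order.trans)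
  qed
  have nonneg: "0 \<le> L" "0 \<le> B" "0 \<le> C1" using LB by (auto simp: C1_def)
  define c where "c p = real (card (multi_idx p q \<times> (coord_idx p :: 'n set set))) * q
      * (real p * real CARD('n) * L + real p * real q * C1) + 1" for p
  have c0: "0 \<le> c p" for p using nonneg by (simp add: c_def)
  let ?P = "{1..min q CARD('n)}"
  \<comment> \<open>The part q B + 1 makes 1/C too short a time for the path to leave the unit ball,
    the sum dominates every Gronwall constant \<open>c p\<close> and so removes the dependence on p,
    and C \<ge> 1 gives the estimate for a single Y_I.\<close>
  define C where "C = q * B + 1 + (\<Sum>p\<in>?P. c p)"
  have sum0: "0 \<le> (\<Sum>p\<in>?P. c p)" by (intro sum_nonneg c0)
  have C_ge: "1 \<le> C" "q * B < C" using sum0 nonneg by (auto simp: C_def add_nonneg_pos)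
  have cC: "c p \<le> C" if "p \<in> ?P" for p
  proof -
    have "c p \<le> (\<Sum>p\<in>?P. c p)" using that c0 by (intro member_le_sum) auto
    then show ?thesis using nonneg by (simp add: C_def add_increasing)
  qed
  show ?thesis
  proof (intro exI[of _ C] conjI ballI allI impI)
    show "0 < C" using C_ge by simp
    fix x T \<gamma> p t
    assume x: "x \<in> \<Omega>" and "subunit_path q g T \<gamma> \<and> \<gamma> 0 = x" and p: "p \<in> ?P" and t: "t \<in> {0..min T (1/C)}"
    then have path: "subunit_path q g T \<gamma>" and x0: "\<gamma> 0 = x" by auto
    have near: "norm (\<gamma> s - \<gamma> 0) < 1" if s: "s \<in> {0..t}" for s
    proof (rule subunit_path_in_unit_ball[OF path _ nonneg(2)])
      show "norm (g j y) \<le> B" if "j < q" "y \<in> cball (\<gamma> 0) 1" for j y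
      proof (rule B[OF that(1)])
        have "norm y \<le> norm x + norm (x - y)" 
          using norm_triangle_ineq4[of x "x - y"] by simp
        then show "y \<in> S" using that(2) R[OF x] x0 by (auto simp: S_def dist_norm)
      qed
      show "s \<in> {0..T}" using s t by auto
      have "q * B * s \<le> q * B * (1 / C)"
        using s t nonneg by (intro mult_left_mono) auto
      also have "\<dots> < 1" using C_ge by (simp add: field_simps)
      finally show "q * B * s < 1" .
    qed
    have ball: "ball (\<gamma> s) 1 \<subseteq> S" if "s \<in> {0..t}" for s
    proof
      fix y assume "y \<in> ball (\<gamma> s) 1"
      moreover have "norm y \<le> norm x + norm (\<gamma> s - x) + norm (\<gamma> s - y)"
        using norm_triangle_ineq[of x "\<gamma> s - x"] norm_triangle_ineq4[of "\<gamma> s" "\<gamma> s - y"] by simp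
      ultimately show "y \<in> S" using near[OF that] R[OF x] x0 by (auto simp: S_def dist_norm)
    qed
    have tT: "t \<in> {0..T}" using t by auto
    have "Lambda_dist q g p (\<gamma> t) x \<le> Lambda_norm q g p x * (exp (c p * t) - 1)"
      using Lambda_path_bound[OF cont _ L B nonneg path tT ball C1, where p=p] x0
      by (simp add: S_def c_def)
    also have "\<dots> \<le> Lambda_norm q g p x * (exp (C * t) - 1)"
      using cC[OF p] t by (intro mult_left_mono Lambda_norm_nonneg) (auto intro: mult_right_mono)
    finally show main: "Lambda_dist q g p (\<gamma> t) x \<le> Lambda_norm q g p x * (exp (C * t) - 1)" .
    fix I assume I: "I \<in> multi_idx p q"
    have "0 \<le> Lambda_norm q g p x * (exp (C * t) - 1)"
      using C_ge t by (intro mult_nonneg_nonneg Lambda_norm_nonneg) auto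
    then have "1 * (Lambda_norm q g p x * (exp (C * t) - 1)) \<le> C * (Lambda_norm q g p x * (exp (C * t) - 1))"
      using C_ge by (intro mult_right_mono)
    then show "YI_dist g p I (\<gamma> t) x \<le> C * Lambda_norm q g p x * (exp (C * t) - 1)"
      using YI_dist_le_Lambda_dist[OF I, of g "\<gamma> t" x] main by (simp add: mult.assoc)
  qed
qed

end
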